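(* Let $g>1$. Suppose $p\in\mathbb C\langle X_1,\dots,X_g,X_1^{\intercal},\dots,X_g^{\intercal}\rangle$ is of degree $u\ge1$ and has $v$ terms. If $p$ vanishes on all $g$-tuples of spherical isometries of size $\lceil\tfrac{g+1}{2}uv\rceil$, then $$p\in\mathcal S=(1-X_1^{\intercal}X_1-\cdots-X_g^{\intercal}X_g).$$
   Context: $\mathbb C\langle X_1,\dots,X_g,X_1^{\intercal},\dots,X_g^{\intercal}\rangle$ is the free associative unital $\mathbb C$-algebra in $2g$ freely noncommuting letters with the conjugate-linear involution exchanging $X_j$ and $X_j^{\intercal}$. The evaluation of $p$ at $A\in M_n(\mathbb C)^g$ replaces $X_j$ by $A_j$ and $X_j^{\intercal}$ by the conjugate transpose $A_j^*$. The number of terms of $p$ is the number of words with nonzero coefficient. A ($g$-tuple of) spherical isometries of size $n$ is a tuple $A=(A_1,\dots,A_g)\in M_n(\mathbb C)^g$ with $A_1^*A_1+\cdots+A_g^*A_g=I_n$. $(\cdots)$ denotes the two-sided ideal generated by the listed element. *)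

theory Defs
  imports
    "HOL-Library.Cardinality"
    "HOL-Library.Poly_Mapping"
    "Jordan_Normal_Form.Schur_Decomposition"
begin

datatype 'g letter = X 'g | XT 'g  \<comment> \<open>\<open>XT j\<close> is the formal adjoint of \<open>X j\<close>\<close>

text \<open>
  The free monoid, written additively: with word concatenation as \<open>+\<close> and the empty word as \<open>0\<close>,
  the convolution product of \<open>\<Rightarrow>\<^sub>0\<close> makes \<open>'g letter free_monoid \<Rightarrow>\<^sub>0 complex\<close> the free
  associative unital complex algebra. (A separate type, since lists carry other additive structures
  elsewhere.)
\<close>

datatype 'a free_monoid = Word (letters: "'a list")

instantiation free_monoid :: (type) monoid_add
begin

definition zero_free_monoid :: "'a free_monoid" where
  "0 = Word []"

definition plus_free_monoid :: "'a free_monoid \<Rightarrow> 'a free_monoid \<Rightarrow> 'a free_monoid" where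
  "v + w = Word (letters v @ letters w)"

instance
  by standard (simp_all add: zero_free_monoid_def plus_free_monoid_def)

end

type_synonym 'g ncpoly = "'g letter free_monoid \<Rightarrow>\<^sub>0 complex"

abbreviation ncletter :: "'g letter \<Rightarrow> 'g ncpoly" where
  "ncletter l \<equiv> Poly_Mapping.single (Word [l]) 1"

text \<open>As usual for natural-valued degrees, the zero polynomial gets degree \<open>0\<close>.\<close>

definition ncdegree :: "'g ncpoly \<Rightarrow> nat" where
  "ncdegree p = Max (insert 0 ((\<lambda>w. length (letters w)) ` Poly_Mapping.keys p))"

definition num_terms :: "'g ncpoly \<Rightarrow> nat" where
  "num_terms p = card (Poly_Mapping.keys p)"

text \<open>
  Matrices of varying size share the type \<open>complex mat\<close>, which therefore has no additive monoid
  structure; sums of \<open>n \<times> n\<close> matrices are taken entrywise.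
\<close>

definition mat_sum :: "nat \<Rightarrow> ('i \<Rightarrow> complex mat) \<Rightarrow> 'i set \<Rightarrow> complex mat" where
  "mat_sum n F I = mat n n (\<lambda>(r, c). \<Sum>i\<in>I. F i $$ (r, c))"

primrec letter_eval :: "('g \<Rightarrow> complex mat) \<Rightarrow> 'g letter \<Rightarrow> complex mat" where
  "letter_eval A (X j) = A j"
| "letter_eval A (XT j) = mat_adjoint (A j)"

definition word_eval ::
    "nat \<Rightarrow> ('g \<Rightarrow> complex mat) \<Rightarrow> 'g letter free_monoid \<Rightarrow> complex mat" where
  "word_eval n A w = foldr (\<lambda>l M. letter_eval A l * M) (letters w) (1\<^sub>m n)"

definition nc_eval :: "nat \<Rightarrow> ('g \<Rightarrow> complex mat) \<Rightarrow> 'g ncpoly \<Rightarrow> complex mat" where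
  "nc_eval n A p =
    mat_sum n (\<lambda>w. Poly_Mapping.lookup p w \<cdot>\<^sub>m word_eval n A w) (Poly_Mapping.keys p)"

definition spherical_isometry :: "nat \<Rightarrow> ('g::finite \<Rightarrow> complex mat) \<Rightarrow> bool" where
  "spherical_isometry n A \<longleftrightarrow>
    (\<forall>j. A j \<in> carrier_mat n n) \<and> mat_sum n (\<lambda>j. mat_adjoint (A j) * A j) UNIV = 1\<^sub>m n"

definition two_sided_ideal :: "'a::ring_1 set \<Rightarrow> bool" where
  "two_sided_ideal I \<longleftrightarrow>
    0 \<in> I \<and> (\<forall>a\<in>I. \<forall>b\<in>I. a + b \<in> I) \<and> (\<forall>a\<in>I. \<forall>r. r * a \<in> I \<and> a * r \<in> I)"

definition spherical_ideal :: "'g::finite ncpoly set" where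
  "spherical_ideal =
    two_sided_ideal hull {1 - (\<Sum>j\<in>UNIV. ncletter (XT j) * ncletter (X j))}"

end

theory Submission
  imports Defs
begin

text \<open>
  Write \<open>g\<close> for the number of variables and \<open>Y\<^sub>j\<close> for the formal adjoint of \<open>X\<^sub>j\<close>. Two
  observations reduce the theorem to linear algebra.

  \<^emph>\<open>Isometries are Zariski dense among left-invertible columns.\<close> A polynomial that vanishes on all spherical
  isometries of size \<open>n\<close> vanishes on all pairs of tuples \<open>(X, Y)\<close> of \<open>n \<times> n\<close> matrices with
  \<open>\<Sum>\<^sub>j Y\<^sub>j X\<^sub>j = 1\<close> (\<open>free_eval_eq_0_of_isometries\<close>). After a change of phase, a Cayley-type
  transformation describes such a pair rationally by matrices \<open>L\<close>, \<open>L'\<close>, \<open>S\<^sub>j\<close>, \<open>T\<^sub>j\<close> with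
  \<open>L + L' = 1 + \<Sum>\<^sub>j S\<^sub>j T\<^sub>j\<close>; parameters with \<open>L' = L\<^sup>*\<close> and \<open>S\<^sub>j = T\<^sub>j\<^sup>*\<close> describe isometries. The
  parameters of a given pair lie, at time \<open>\<i>\<close>, on a polynomial curve of parameters that satisfy these
  adjointness conditions at real times. Along it the entries of the values of the polynomial are rational
  functions of the time. They vanish at all but finitely many real times, hence at \<open>\<i>\<close>.

  \<^emph>\<open>The quotient algebra acts on small spaces up to truncation.\<close> Let \<open>K\<close> consist of all suffixes of
  the words of \<open>p\<close>, so that \<open>K\<close> has at most \<open>uv + 1\<close> elements, and let \<open>V\<close> be the span of \<open>K\<close> in the
  quotient by the ideal. Left multiplication by \<open>X\<^sub>j\<close> and \<open>Y\<^sub>j\<close> is defined on subspaces of \<open>V\<close> only, but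
  by a dimension count it extends to a pair of tuples of operators on a space of dimension \<open>n > uv\<close> which
  still satisfies \<open>\<Sum>\<^sub>j Y\<^sub>j X\<^sub>j = 1\<close> (\<open>left_inverse_pair_extending_words\<close>). Evaluated at these operators, \<open>p\<close>
  sends the class of \<open>1\<close> to the class of \<open>p\<close>. So if \<open>p\<close> vanishes at the pair, then the class of \<open>p\<close> is
  zero, that is, \<open>p\<close> is in the ideal. For \<open>p \<noteq> 0\<close> the size \<open>\<lceil>(g + 1) u v / 2\<rceil>\<close> exceeds \<open>uv\<close>, since \<open>g \<ge> 2\<close>.

  The count behind the extension: first \<open>X\<^sub>j\<close> is extended to the sum \<open>E\<close> of the domains of all
  \<open>X\<^sub>i\<close>, injectively modulo the domain \<open>F\<^sub>j\<close> of \<open>Y\<^sub>j\<close> off its own domain; then the column \<open>X\<close> is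
  extended from \<open>E\<close> to the whole space, injectively modulo \<open>\<Oplus>\<^sub>j F\<^sub>j\<close> off \<open>E\<close>. A vector that the
  resulting column sends to \<open>\<Oplus>\<^sub>j F\<^sub>j\<close> then lies in the domains of all the original \<open>X\<^sub>j\<close>, where the
  relation of the quotient algebra makes \<open>Y\<close> undo \<open>X\<close>. Hence \<open>Y\<close> may be prescribed on \<open>\<Oplus>\<^sub>j F\<^sub>j\<close> and
  on the range of \<open>X\<close> simultaneously. Both extensions have room because the dimensions of \<open>E\<close> and \<open>\<Oplus>\<^sub>j F\<^sub>j\<close>
  add up to at most \<open>uv\<close>.
\<close>

section \<open>Linear maps with prescribed values\<close>

text \<open>
  Well-definedness of a map given on the image of \<open>f\<close>: compose \<open>g\<close> with a linear right inverse of \<open>f\<close>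
  with values in \<open>V\<close>; the condition on kernels makes the choice irrelevant.
\<close>

lemma (in vector_space_pair) linear_factor_through:
  assumes f: "Vector_Spaces.linear s1 s2 f" and V: "vs1.subspace V"
    and g: "Vector_Spaces.linear s1 s3 g"
    and ker: "\<And>x. x \<in> V \<Longrightarrow> f x = 0 \<Longrightarrow> g x = 0"
  obtains h where "Vector_Spaces.linear s2 s3 h" "\<forall>x\<in>V. h (f x) = g x"
proof -
  obtain r where r: "range r \<subseteq> V" "Vector_Spaces.linear s2 s1 r" "\<forall>y\<in>f ` V. f (r y) = y"
    using linear_exists_right_inverse_on[OF f V] by (elim exE conjE)
  have lin: "Vector_Spaces.linear s2 s3 (g \<circ> r)"
    by (rule Vector_Spaces.linear_compose[OF r(2) g])
  have "g (r (f x)) = g x" if x: "x \<in> V" for x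
  proof -
    have "f (r (f x) - x) = f (r (f x)) - f x" by (rule linear_diff[OF f])
    also have "\<dots> = 0" using r(3) x by simp
    finally have "f (r (f x) - x) = 0" .
    moreover have "r (f x) - x \<in> V"
      using r(1) x by (intro vs1.subspace_diff[OF V]) auto
    ultimately have "g (r (f x) - x) = 0" by (rule ker[rotated])
    moreover have "g (r (f x) - x) = g (r (f x)) - g x"
      using g unfolding linear_iff_module_hom by (rule module_hom.diff)
    ultimately show ?thesis by simp
  qed
  then show thesis using that[OF lin] by simp
qed

text \<open>
  One vector of \<open>Q\<close> is treated at a time. The span of \<open>A\<close> together with the values chosen so far has
  dimension less than \<open>card M\<close>, so some element of \<open>W\<close> lies outside it and can serve as the value at the
  next vector; then no vector with a nonzero coefficient there is mapped into the span of \<open>A\<close>. Counting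
  generators instead of dimensions avoids any appeal to finite-dimensionality of the ambient spaces.
\<close>

lemma (in vector_space_pair) linear_extend_injectively_modulo:
  assumes T: "Vector_Spaces.linear s1 s2 T" and Q: "finite Q" "P \<subseteq> Q" and W: "vs2.subspace W" "T ` P \<subseteq> W"
    and A: "finite A" and M: "vs2.independent M" "M \<subseteq> W" "card Q + card A \<le> card M"
  obtains T' where "Vector_Spaces.linear s1 s2 T'" "\<forall>x\<in>vs1.span P. T' x = T x" "T' ` Q \<subseteq> W"
    "\<forall>v\<in>vs1.span Q. T' v \<in> vs2.span A \<longrightarrow> v \<in> vs1.span P"
proof -
  have "\<exists>T'. Vector_Spaces.linear s1 s2 T' \<and> (\<forall>x\<in>vs1.span P. T' x = T x) \<and> T' ` (P \<union> D) \<subseteq> W \<and>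
    (\<forall>v\<in>vs1.span (P \<union> D). T' v \<in> vs2.span A \<longrightarrow> v \<in> vs1.span P)"
    if "finite D" "D \<subseteq> Q - P" for D
    using that
  proof (induction rule: finite_induct)
    case empty
    show ?case using T W by auto
  next
    case (insert q D)
    let ?R = "P \<union> D"
    have finR: "finite ?R" using insert Q finite_subset by auto
    from insert obtain T' where T': "Vector_Spaces.linear s1 s2 T'" "\<forall>x\<in>vs1.span P. T' x = T x" "T' ` ?R \<subseteq> W"
      "\<forall>v\<in>vs1.span ?R. T' v \<in> vs2.span A \<longrightarrow> v \<in> vs1.span P" by auto
    have spR: "T' x \<in> W" if "x \<in> vs1.span ?R" for x
    proof -
      have "T' x \<in> vs2.span (T' ` ?R)" using that linear_span_image[OF T'(1)] by blast
      then show ?thesis using vs2.span_minimal[OF T'(3) W(1)] by blast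
    qed
    show ?case
    proof (cases "q \<in> vs1.span ?R")
      case True
      have "vs1.span (P \<union> insert q D) = vs1.span ?R"
        using vs1.span_redundant[OF True] by simp
      then show ?thesis using T' spR[OF True] by (intro exI[of _ T']) auto
    next
      case False
      have "q \<notin> ?R" using False vs1.span_base by blast
      then have "card ?R < card Q"
        using insert.prems Q finR by (intro psubset_card_mono) auto
      moreover have "card (A \<union> T' ` ?R) \<le> card A + card ?R"
        using card_Un_le[of A "T' ` ?R"] card_image_le[OF finR, of T'] by linarith
      ultimately have lt: "card (A \<union> T' ` ?R) < card M" using M(3) by linarith
      have "\<not> M \<subseteq> vs2.span (A \<union> T' ` ?R)"
        using vs2.independent_span_bound[OF _ M(1), of "A \<union> T' ` ?R"] lt A finR by fastforce
      then obtain w where w: "w \<in> W" "w \<notin> vs2.span (A \<union> T' ` ?R)" using M(2) by blast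
      \<comment> \<open>a basis of the old span is needed to prescribe the value at \<open>q\<close> without changing the old values\<close>
      obtain B where B: "B \<subseteq> ?R" "vs1.independent B" "?R \<subseteq> vs1.span B"
        by (rule vs1.maximal_independent_subset)
      have spB: "vs1.span B = vs1.span ?R"
        using B by (metis vs1.span_eq vs1.span_superset subset_trans)
      have ind: "vs1.independent (insert q B)"
        using False B(2) spB by (intro vs1.independent_insertI) auto
      define T'' where "T'' = construct (insert q B) (\<lambda>x. if x = q then w else T' x)"
      have lin: "Vector_Spaces.linear s1 s2 T''" unfolding T''_def by (rule linear_construct[OF ind])
      have T''q: "T'' q = w" unfolding T''_def by (subst construct_basis[OF ind]) auto
      have T''R: "T'' x = T' x" if "x \<in> vs1.span ?R" for x
      proof (rule linear_eq_on[OF lin T'(1)])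
        show "x \<in> vs1.span B" using that spB by simp
        fix b assume b: "b \<in> B"
        then have "b \<noteq> q" using False spB vs1.span_base by blast
        then show "T'' b = T' b" unfolding T''_def using b by (subst construct_basis[OF ind]) auto
      qed
      have "v \<in> vs1.span P" if v: "v \<in> vs1.span (insert q ?R)" "T'' v \<in> vs2.span A" for v
      proof -
        obtain k where k: "v - s1 k q \<in> vs1.span ?R" using vs1.span_breakdown_eq v(1) by blast
        have *: "T'' v = T' (v - s1 k q) + s2 k w"
          using T''R[OF k] T''q by (simp add: linear_diff[OF lin] linear_scale[OF lin] algebra_simps)
        have "T' (v - s1 k q) \<in> vs2.span (T' ` ?R)" using k linear_span_image[OF T'(1)] by blast
        then have "T' (v - s1 k q) \<in> vs2.span (A \<union> T' ` ?R)"
          using vs2.span_mono[of "T' ` ?R" "A \<union> T' ` ?R"] by blast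
        moreover have "T'' v \<in> vs2.span (A \<union> T' ` ?R)"
          using v(2) vs2.span_mono[of A "A \<union> T' ` ?R"] by blast
        ultimately have "s2 k w \<in> vs2.span (A \<union> T' ` ?R)"
          using * vs2.span_diff by (metis add_diff_cancel_left')
        then have "s2 (inverse k) (s2 k w) \<in> vs2.span (A \<union> T' ` ?R)" by (rule vs2.span_scale)
        then have k0: "k = 0" using w(2) by (cases "k = 0") auto
        then have "v \<in> vs1.span ?R" using k by simp
        then show ?thesis using T'(4) v(2) T''R by metis
      qed
      moreover have "T'' x = T x" if "x \<in> vs1.span P" for x
      proof -
        have "x \<in> vs1.span ?R" using that vs1.span_mono[of P ?R] by blast
        then show ?thesis using T''R T'(2) that by simp
      qed
      moreover have "T'' ` (P \<union> insert q D) \<subseteq> W"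
        using T''q w(1) T''R T'(3) vs1.span_base[of _ ?R] by auto
      ultimately show ?thesis using lin by (intro exI[of _ T'']) auto
    qed
  qed
  note ex = this
  have PQ: "P \<union> (Q - P) = Q" using Q by auto
  show thesis using ex[of "Q - P", unfolded PQ] Q(1) that by blast
qed

section \<open>Finitely supported functions as vector spaces\<close>

definition pscale :: "complex \<Rightarrow> ('a \<Rightarrow>\<^sub>0 complex) \<Rightarrow> 'a \<Rightarrow>\<^sub>0 complex" where
  "pscale c = Poly_Mapping.map ((*) c)"

lemma lookup_pscale [simp]: "Poly_Mapping.lookup (pscale c p) k = c * Poly_Mapping.lookup p k"
  unfolding pscale_def by (simp add: map.rep_eq when_def)

interpretation pm: vector_space pscale
  by standard (auto intro!: poly_mapping_eqI simp: lookup_add distrib_left distrib_right)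

interpretation pmp: vector_space_pair pscale pscale
  by standard

abbreviation plinear :: "(('a \<Rightarrow>\<^sub>0 complex) \<Rightarrow> ('b \<Rightarrow>\<^sub>0 complex)) \<Rightarrow> bool" where
  "plinear \<equiv> Vector_Spaces.linear pscale pscale"

abbreviation pdelta :: "'a \<Rightarrow> 'a \<Rightarrow>\<^sub>0 complex" where
  "pdelta k \<equiv> Poly_Mapping.single k 1"

lemma sum_pscale_pdelta:
  assumes "finite K" "Poly_Mapping.keys p \<subseteq> K"
  shows "(\<Sum>k\<in>K. pscale (Poly_Mapping.lookup p k) (pdelta k)) = p"
proof (rule poly_mapping_eqI)
  fix j
  have "(\<Sum>k\<in>K. Poly_Mapping.lookup p k * (1 when k = j)) = (if j \<in> K then Poly_Mapping.lookup p j else 0)"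
    using assms(1) by (simp add: when_def if_distrib cong: if_cong)
  also have "\<dots> = Poly_Mapping.lookup p j"
    using assms(2) by (auto simp: in_keys_iff)
  finally show "Poly_Mapping.lookup (\<Sum>k\<in>K. pscale (Poly_Mapping.lookup p k) (pdelta k)) j =
      Poly_Mapping.lookup p j"
    by (simp add: lookup_sum lookup_single)
qed

lemma in_span_pdelta_iff: "p \<in> pm.span (pdelta ` K) \<longleftrightarrow> Poly_Mapping.keys p \<subseteq> K"
proof
  assume "p \<in> pm.span (pdelta ` K)"
  then show "Poly_Mapping.keys p \<subseteq> K"
  proof (induction rule: pm.span_induct)
    case base
    show ?case
      by (rule pm.subspaceI) (auto simp: subset_iff in_keys_iff lookup_add, metis add.right_neutral)
  qed (auto split: if_splits)
next
  assume "Poly_Mapping.keys p \<subseteq> K"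
  then show "p \<in> pm.span (pdelta ` K)"
    by (subst sum_pscale_pdelta[OF finite_keys subset_refl, symmetric])
       (intro pm.span_sum pm.span_scale pm.span_base, blast)
qed

lemma pdelta_eq_iff [simp]: "pdelta x = pdelta y \<longleftrightarrow> x = y"
  by (metis lookup_single_eq lookup_single_not_eq zero_neq_one)

lemma independent_pdelta: "pm.independent (pdelta ` K)"
proof -
  have "pdelta k \<notin> pm.span (pdelta ` K - {pdelta k})" for k :: 'a
  proof
    assume a: "pdelta k \<in> pm.span (pdelta ` K - {pdelta k})"
    have "pdelta ` K - {pdelta k} \<subseteq> pdelta ` (K - {k})" by auto
    then have "pdelta k \<in> pm.span (pdelta ` (K - {k}))" using a pm.span_mono by blast
    then show False unfolding in_span_pdelta_iff by simp
  qed
  then show ?thesis unfolding pm.dependent_def by blast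
qed

lemma plinear_sum_pdelta:
  assumes "plinear f" "finite K" "Poly_Mapping.keys p \<subseteq> K"
  shows "f p = (\<Sum>k\<in>K. pscale (Poly_Mapping.lookup p k) (f (pdelta k)))"
proof -
  interpret f: Vector_Spaces.linear pscale pscale f by fact
  have "f p = f (\<Sum>k\<in>K. pscale (Poly_Mapping.lookup p k) (pdelta k))"
    using sum_pscale_pdelta[OF assms(2,3)] by simp
  then show ?thesis by (simp add: f.sum f.scale)
qed

lemma plinear_exists:
  obtains f where "plinear f" "\<forall>k. f (pdelta k) = a k"
proof (rule that)
  let ?f = "pmp.construct (range pdelta) (\<lambda>x. a (inv_into UNIV pdelta x))"
  show "plinear ?f" by (rule pmp.linear_construct[OF independent_pdelta])
  have "?f (pdelta k) = a k" for k
    by (subst pmp.construct_basis[OF independent_pdelta]) (auto intro!: arg_cong[of _ _ a] inv_into_f_f inj_onI)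
  then show "\<forall>k. ?f (pdelta k) = a k" by blast
qed

text \<open>
  Subtracting from the identity a linear projection onto \<open>S\<close> gives a model of the quotient by \<open>S\<close>
  inside the space itself.
\<close>

lemma plinear_with_kernel:
  assumes "pm.subspace S"
  obtains f :: "('a \<Rightarrow>\<^sub>0 complex) \<Rightarrow> ('a \<Rightarrow>\<^sub>0 complex)" where "plinear f" "\<forall>x. f x = 0 \<longleftrightarrow> x \<in> S"
proof -
  obtain B where B: "B \<subseteq> S" "pm.independent B" "S \<subseteq> pm.span B"
    by (rule pm.maximal_independent_subset)
  have SB: "pm.span B = S" using B assms pm.span_minimal[OF B(1) assms] by auto
  let ?r = "pmp.construct B (\<lambda>x. x)"
  have lr: "plinear ?r" by (rule pmp.linear_construct[OF B(2)])
  have rB: "?r x \<in> S" for x using pmp.construct_in_span[OF B(2), of "\<lambda>x. x" x] SB by simp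
  have rS: "?r x = x" if "x \<in> S" for x
    by (rule pmp.linear_eq_on[OF lr pm.linear_ident, of x B])
       (use that SB pmp.construct_basis[OF B(2)] in auto)
  show thesis
  proof (rule that[of "\<lambda>x. x - ?r x"])
    show "plinear (\<lambda>x. x - ?r x)"
      by (rule pmp.linear_compose_sub[OF pm.linear_ident lr])
    have "(x - ?r x = 0) = (x \<in> S)" for x
      using rB[of x] rS[of x] by auto
    then show "\<forall>x. (x - ?r x = 0) = (x \<in> S)" by blast
  qed
qed

text \<open>
  Coordinates on the image of the span of \<open>K\<close> in the quotient by \<open>S\<close>: this image is spanned by \<open>card K\<close>
  vectors, so that \<open>n\<close> coordinates suffice.
\<close>

lemma plinear_coordinates_modulo:
  fixes S :: "('a \<Rightarrow>\<^sub>0 complex) set"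
  assumes S: "pm.subspace S" and K: "finite K" "card K \<le> n"
  obtains f :: "('a \<Rightarrow>\<^sub>0 complex) \<Rightarrow> (nat \<Rightarrow>\<^sub>0 complex)"
  where "plinear f" "\<forall>x. Poly_Mapping.keys (f x) \<subseteq> {..<n}"
    "\<forall>x. Poly_Mapping.keys x \<subseteq> K \<longrightarrow> (f x = 0 \<longleftrightarrow> x \<in> S)"
proof -
  obtain \<pi> :: "('a \<Rightarrow>\<^sub>0 complex) \<Rightarrow> ('a \<Rightarrow>\<^sub>0 complex)"
    where p: "plinear \<pi>" "\<forall>x. \<pi> x = 0 \<longleftrightarrow> x \<in> S" by (rule plinear_with_kernel[OF S])
  obtain B where B: "B \<subseteq> \<pi> ` pdelta ` K" "pm.independent B" "\<pi> ` pdelta ` K \<subseteq> pm.span B"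
    by (rule pm.maximal_independent_subset)
  have finB: "finite B" using B(1) K finite_subset by blast
  have "card B \<le> card (\<pi> ` pdelta ` K)" using B(1) K by (intro card_mono) auto
  also have "\<dots> \<le> n"
    using K by (meson card_image_le finite_imageI order_trans)
  finally obtain e where i: "e ` B \<subseteq> {..<n}" "inj_on e B"
    using card_le_inj[OF finB, of "{..<n}"] by auto
  let ?c = "pmp.construct B (\<lambda>b. pdelta (e b))"
  have lc: "plinear ?c" by (rule pmp.linear_construct[OF B(2)])
  have cb: "?c b = pdelta (e b)" if "b \<in> B" for b
    by (rule pmp.construct_basis[OF B(2) that])
  have im: "?c ` B = pdelta ` e ` B" using cb by (simp add: image_image)
  have injB: "inj_on ?c B"
  proof (rule inj_onI)
    fix x y assume xy: "x \<in> B" "y \<in> B" "?c x = ?c y"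
    then have "pdelta (e x) = pdelta (e y)" using cb by simp
    then have "e x = e y" by simp
    then show "x = y" using i(2) xy by (auto dest: inj_onD)
  qed
  have ind: "pm.independent (?c ` B)" by (subst im) (rule independent_pdelta)
  have inj: "inj_on ?c (pm.span B)"
    by (rule pmp.linear_inj_on_span_independent_image[OF lc ind injB])
  have lf: "plinear (?c \<circ> \<pi>)" by (rule Vector_Spaces.linear_compose[OF p(1) lc])
  show thesis
  proof (rule that[OF lf]; intro allI impI)
    fix x
    have "(?c \<circ> \<pi>) x \<in> pm.span (pdelta ` e ` B)"
      using pmp.construct_in_span[OF B(2), of "\<lambda>b. pdelta (e b)" "\<pi> x"] by (simp add: image_image)
    then show "Poly_Mapping.keys ((?c \<circ> \<pi>) x) \<subseteq> {..<n}"
      unfolding in_span_pdelta_iff using i(1) by blast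
  next
    fix x :: "'a \<Rightarrow>\<^sub>0 complex" assume "Poly_Mapping.keys x \<subseteq> K"
    then have "x \<in> pm.span (pdelta ` K)" by (simp add: in_span_pdelta_iff)
    then have "\<pi> x \<in> pm.span (\<pi> ` pdelta ` K)" using pmp.linear_span_image[OF p(1)] by blast
    then have "\<pi> x \<in> pm.span B"
      using pm.span_minimal[OF B(3) pm.subspace_span] by (rule subsetD[rotated])
    moreover have "?c 0 = 0" by (rule pmp.linear_0[OF lc])
    ultimately have "?c (\<pi> x) = 0 \<longleftrightarrow> \<pi> x = 0"
      using inj_onD[OF inj, of "\<pi> x" 0] pm.span_zero[of B] by metis
    then show "(?c \<circ> \<pi>) x = 0 \<longleftrightarrow> x \<in> S" by (simp add: p(2))
  qed
qed

lemma lookup_plinear: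
  assumes "plinear f" "finite I" "Poly_Mapping.keys x \<subseteq> I"
  shows "Poly_Mapping.lookup (f x) r = (\<Sum>k\<in>I. Poly_Mapping.lookup x k * Poly_Mapping.lookup (f (pdelta k)) r)"
  by (subst plinear_sum_pdelta[OF assms]) (simp add: lookup_sum)

text \<open>
  Finitely supported functions on \<open>'i \<times> nat\<close> serve as tuples, indexed by \<open>'i\<close>, of vectors.
\<close>

lemma component_embeddings:
  obtains emb :: "'i::finite \<Rightarrow> (nat \<Rightarrow>\<^sub>0 complex) \<Rightarrow> ('i \<times> nat \<Rightarrow>\<^sub>0 complex)"
  where "\<forall>i. plinear (emb i)" "\<forall>i k. emb i (pdelta k) = pdelta (i, k)"
    "\<forall>x i k. Poly_Mapping.lookup (\<Sum>j\<in>UNIV. emb j (x j)) (i, k) = Poly_Mapping.lookup (x i) k"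
proof -
  have "\<exists>f. plinear f \<and> (\<forall>k. f (pdelta k) = pdelta (i, k))" for i :: 'i
    by (rule plinear_exists[of "\<lambda>k. pdelta (i, k)"]) blast
  then obtain emb :: "'i \<Rightarrow> (nat \<Rightarrow>\<^sub>0 complex) \<Rightarrow> ('i \<times> nat \<Rightarrow>\<^sub>0 complex)"
    where emb: "\<And>i. plinear (emb i)" "\<And>i k. emb i (pdelta k) = pdelta (i, k)" by metis
  have "Poly_Mapping.lookup (emb j x) (i, k) = (if j = i then Poly_Mapping.lookup x k else 0)" for i j k x
  proof -
    have "Poly_Mapping.lookup (emb j x) (i, k) =
        (\<Sum>l\<in>Poly_Mapping.keys x. Poly_Mapping.lookup x l * (1 when (j, l) = (i, k)))"
      by (subst lookup_plinear[OF emb(1) finite_keys subset_refl]) (simp add: emb(2) lookup_single)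
    also have "\<dots> = (if j = i then Poly_Mapping.lookup x k else 0)"
      by (auto simp: when_def if_distrib in_keys_iff cong: if_cong)
    finally show ?thesis .
  qed
  then show thesis using emb by (intro that[of emb]) (simp_all add: lookup_sum)
qed

lemma span_image_pdelta:
  assumes "plinear f"
  shows "pm.span ((\<lambda>s. f (pdelta s)) ` K) = f ` {x. Poly_Mapping.keys x \<subseteq> K}"
proof -
  have "pm.span (f ` pdelta ` K) = f ` pm.span (pdelta ` K)"
    by (rule pmp.linear_span_image[OF assms])
  also have "pm.span (pdelta ` K) = {x. Poly_Mapping.keys x \<subseteq> K}"
    by (simp add: set_eq_iff in_span_pdelta_iff)
  finally show ?thesis by (simp add: image_image)
qed

section \<open>Sums, adjoints and inverses of square matrices\<close>

lemma mult_mat_entry: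
  assumes "A \<in> carrier_mat n n" "B \<in> carrier_mat n n" "i < n" "j < n"
  shows "(A * B) $$ (i, j) = (\<Sum>k<n. A $$ (i, k) * B $$ (k, j))"
  using assms by (auto simp: scalar_prod_def atLeast0LessThan intro!: sum.cong)

lemma mat_sum_carrier [simp]: "mat_sum n F I \<in> carrier_mat n n"
  by (simp add: mat_sum_def)

lemma mat_sum_entry [simp]: "r < n \<Longrightarrow> c < n \<Longrightarrow> mat_sum n F I $$ (r, c) = (\<Sum>i\<in>I. F i $$ (r, c))"
  by (simp add: mat_sum_def)

lemma mat_sum_dim [simp]: "dim_row (mat_sum n F I) = n" "dim_col (mat_sum n F I) = n"
  by (simp_all add: mat_sum_def)

lemma mat_sum_cong: "(\<And>i. i \<in> I \<Longrightarrow> F i = G i) \<Longrightarrow> mat_sum n F I = mat_sum n G I"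
  by (rule eq_matI) auto

lemma mult_mat_sum:
  assumes A: "A \<in> carrier_mat n n" and F: "\<And>i. i \<in> I \<Longrightarrow> F i \<in> carrier_mat n n"
  shows "A * mat_sum n F I = mat_sum n (\<lambda>i. A * F i) I"
proof (rule eq_matI)
  fix r c assume "r < dim_row (mat_sum n (\<lambda>i. A * F i) I)" "c < dim_col (mat_sum n (\<lambda>i. A * F i) I)"
  then have rc: "r < n" "c < n" by auto
  have "(A * mat_sum n F I) $$ (r, c) = (\<Sum>k<n. A $$ (r, k) * (\<Sum>i\<in>I. F i $$ (k, c)))"
    using rc by (simp add: mult_mat_entry[OF A mat_sum_carrier rc])
  also have "\<dots> = (\<Sum>i\<in>I. \<Sum>k<n. A $$ (r, k) * F i $$ (k, c))"
    unfolding sum_distrib_left by (rule sum.swap)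
  also have "\<dots> = (\<Sum>i\<in>I. (A * F i) $$ (r, c))"
    using F by (intro sum.cong refl) (simp add: mult_mat_entry[OF A _ rc])
  finally show "(A * mat_sum n F I) $$ (r, c) = mat_sum n (\<lambda>i. A * F i) I $$ (r, c)"
    using rc by simp
qed (use A in auto)

lemma mat_sum_mult:
  assumes A: "A \<in> carrier_mat n n" and F: "\<And>i. i \<in> I \<Longrightarrow> F i \<in> carrier_mat n n"
  shows "mat_sum n F I * A = mat_sum n (\<lambda>i. F i * A) I"
proof (rule eq_matI)
  fix r c assume "r < dim_row (mat_sum n (\<lambda>i. F i * A) I)" "c < dim_col (mat_sum n (\<lambda>i. F i * A) I)"
  then have rc: "r < n" "c < n" by auto
  have "(mat_sum n F I * A) $$ (r, c) = (\<Sum>k<n. (\<Sum>i\<in>I. F i $$ (r, k)) * A $$ (k, c))"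
    using rc by (simp add: mult_mat_entry[OF mat_sum_carrier A rc])
  also have "\<dots> = (\<Sum>i\<in>I. \<Sum>k<n. F i $$ (r, k) * A $$ (k, c))"
    unfolding sum_distrib_right by (rule sum.swap)
  also have "\<dots> = (\<Sum>i\<in>I. (F i * A) $$ (r, c))"
    using F by (intro sum.cong refl) (simp add: mult_mat_entry[OF _ A rc])
  finally show "(mat_sum n F I * A) $$ (r, c) = mat_sum n (\<lambda>i. F i * A) I $$ (r, c)"
    using rc by simp
qed (use A in auto)

lemma mat_sum_remove:
  assumes "finite I" "i \<in> I" "F i \<in> carrier_mat n n"
  shows "mat_sum n F I = F i + mat_sum n F (I - {i})"
  by (rule eq_matI) (use assms in \<open>auto simp: sum.remove[OF assms(1,2)]\<close>)

lemma mat_adjoint_carrier [simp]: "(A :: complex mat) \<in> carrier_mat n n \<Longrightarrow> mat_adjoint A \<in> carrier_mat n n"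
  by (auto simp: mat_adjoint_def mat_of_rows_def)

lemma mat_adjoint_entry:
  "(A :: complex mat) \<in> carrier_mat n n \<Longrightarrow> i < n \<Longrightarrow> j < n \<Longrightarrow> mat_adjoint A $$ (i, j) = cnj (A $$ (j, i))"
  by (auto simp: mat_adjoint_def mat_of_rows_index)

lemma mat_adjoint_mult:
  fixes A B :: "complex mat"
  assumes A: "A \<in> carrier_mat n n" and B: "B \<in> carrier_mat n n"
  shows "mat_adjoint (A * B) = mat_adjoint B * mat_adjoint A"
proof (rule eq_matI)
  fix i j assume "i < dim_row (mat_adjoint B * mat_adjoint A)" "j < dim_col (mat_adjoint B * mat_adjoint A)"
  then have ij: "i < n" "j < n"
    using mat_adjoint_carrier[OF A] mat_adjoint_carrier[OF B] by auto
  show "mat_adjoint (A * B) $$ (i, j) = (mat_adjoint B * mat_adjoint A) $$ (i, j)"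
    unfolding mat_adjoint_entry[OF mult_carrier_mat[OF A B] ij] mult_mat_entry[OF A B ij(2,1)]
      mult_mat_entry[OF mat_adjoint_carrier[OF B] mat_adjoint_carrier[OF A] ij]
    by (auto simp: mat_adjoint_entry[OF A] mat_adjoint_entry[OF B] ij intro!: sum.cong)
qed (use mat_adjoint_carrier[OF mult_carrier_mat[OF A B]] mat_adjoint_carrier[OF A]
      mat_adjoint_carrier[OF B] in auto)

lemma mat_adjoint_sum:
  assumes F: "\<And>i. i \<in> I \<Longrightarrow> F i \<in> carrier_mat n n"
  shows "mat_adjoint (mat_sum n F I) = mat_sum n (\<lambda>i. mat_adjoint (F i)) I"
  using carrier_matD[OF mat_adjoint_carrier[OF mat_sum_carrier[of n F I]]]
  by (intro eq_matI) (auto simp: mat_adjoint_entry[OF mat_sum_carrier] mat_adjoint_entry[OF F] intro!: sum.cong)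

lemma mat_adjoint_one [simp]: "mat_adjoint (1\<^sub>m n :: complex mat) = 1\<^sub>m n"
  using carrier_matD[OF mat_adjoint_carrier[OF one_carrier_mat[of n]]]
  by (intro eq_matI) (auto simp: mat_adjoint_entry[OF one_carrier_mat])

lemma mat_adjoint_phase:
  fixes N :: "complex mat"
  assumes "N \<in> carrier_mat n n"
  shows "mat_adjoint (c \<cdot>\<^sub>m (1\<^sub>m n - N)) = cnj c \<cdot>\<^sub>m (1\<^sub>m n - mat_adjoint N)"
proof -
  have c: "c \<cdot>\<^sub>m (1\<^sub>m n - N) \<in> carrier_mat n n" using assms by (simp add: minus_carrier_mat)
  show ?thesis
    using carrier_matD[OF mat_adjoint_carrier[OF c]] carrier_matD[OF mat_adjoint_carrier[OF assms]] assms
    by (intro eq_matI) (auto simp: mat_adjoint_entry[OF c] mat_adjoint_entry[OF assms])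
qed

lemma phase_cancel:
  assumes w: "w * cnj w = 1" and A: "A \<in> carrier_mat n n"
  shows "cnj w \<cdot>\<^sub>m (1\<^sub>m n - (1\<^sub>m n - w \<cdot>\<^sub>m A)) = A" "w \<cdot>\<^sub>m (1\<^sub>m n - (1\<^sub>m n - cnj w \<cdot>\<^sub>m A)) = A"
proof -
  have w': "cnj w * (w * x) = x" "w * (cnj w * x) = x" for x
    using w by (simp_all add: mult.assoc[symmetric] mult.commute[of "cnj w" w])
  show "cnj w \<cdot>\<^sub>m (1\<^sub>m n - (1\<^sub>m n - w \<cdot>\<^sub>m A)) = A" "w \<cdot>\<^sub>m (1\<^sub>m n - (1\<^sub>m n - cnj w \<cdot>\<^sub>m A)) = A"
    using A by (auto intro!: eq_matI simp: w')
qed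

lemma smult_mult_smult_phase:
  assumes w: "w * cnj w = 1" and A: "A \<in> carrier_mat n n" and C: "C \<in> carrier_mat n n"
  shows "(w \<cdot>\<^sub>m C) * (cnj w \<cdot>\<^sub>m A) = C * A"
proof -
  have "(w \<cdot>\<^sub>m C) * (cnj w \<cdot>\<^sub>m A) = w \<cdot>\<^sub>m (cnj w \<cdot>\<^sub>m (C * A))"
    using mult_smult_assoc_mat[OF C smult_carrier_mat[OF A]] mult_smult_distrib[OF C A] by simp
  also have "\<dots> = (w * cnj w) \<cdot>\<^sub>m (C * A)"
    by (intro eq_matI) auto
  also have "\<dots> = C * A" unfolding w by (intro eq_matI) auto
  finally show ?thesis .
qed

lemma mat_inverse_exists:
  fixes N :: "complex mat"
  assumes N: "N \<in> carrier_mat n n" and det: "det N \<noteq> 0"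
  obtains L where "L \<in> carrier_mat n n" "L * N = 1\<^sub>m n" "N * L = 1\<^sub>m n"
proof
  note adj = adj_mat[OF N]
  show "(1 / det N) \<cdot>\<^sub>m adj_mat N \<in> carrier_mat n n" using adj by simp
  have [simp]: "(1 / det N) \<cdot>\<^sub>m (det N \<cdot>\<^sub>m 1\<^sub>m n) = 1\<^sub>m n"
    using det by (intro eq_matI) auto
  show "(1 / det N) \<cdot>\<^sub>m adj_mat N * N = 1\<^sub>m n"
    using mult_smult_assoc_mat[OF adj(1) N] adj by simp
  show "N * ((1 / det N) \<cdot>\<^sub>m adj_mat N) = 1\<^sub>m n"
    using mult_smult_distrib[OF N adj(1)] adj by simp
qed

lemma mat_inverse_from_scalar:
  fixes F G :: "complex mat"
  assumes F: "F \<in> carrier_mat n n" and G: "G \<in> carrier_mat n n" and d: "d \<noteq> 0"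
    and FG: "F * G = d \<cdot>\<^sub>m 1\<^sub>m n" "G * F = d \<cdot>\<^sub>m 1\<^sub>m n"
  shows "F * ((1 / d) \<cdot>\<^sub>m G) = 1\<^sub>m n" "(1 / d) \<cdot>\<^sub>m G * F = 1\<^sub>m n"
proof -
  have e: "(1 / d) \<cdot>\<^sub>m (d \<cdot>\<^sub>m 1\<^sub>m n) = (1\<^sub>m n :: complex mat)"
    using d by (intro eq_matI) auto
  show "F * ((1 / d) \<cdot>\<^sub>m G) = 1\<^sub>m n" unfolding mult_smult_distrib[OF F G] FG e ..
  show "(1 / d) \<cdot>\<^sub>m G * F = 1\<^sub>m n" unfolding mult_smult_assoc_mat[OF G F] FG e ..
qed

lemma mat_inverse_unique:
  fixes L N N' :: "complex mat"
  assumes "L \<in> carrier_mat n n" "N \<in> carrier_mat n n" "N' \<in> carrier_mat n n"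
    and "N * L = 1\<^sub>m n" "L * N' = 1\<^sub>m n"
  shows "N = N'"
proof -
  have "N * (L * N') = N * L * N'" using assms by (intro assoc_mult_mat[symmetric]) auto
  then show ?thesis using assms by simp
qed

section \<open>Matrices of rational functions\<close>

text \<open>
  Rational functions all of whose poles are zeros of \<open>D\<close>. Values at the zeros of \<open>D\<close> are left
  arbitrary, since the inverse matrices occurring below are meaningless there.
\<close>

definition regular_off :: "complex poly \<Rightarrow> (complex \<Rightarrow> complex) \<Rightarrow> bool" where
  "regular_off D f \<longleftrightarrow> (\<exists>q k. \<forall>z. poly D z \<noteq> 0 \<longrightarrow> f z * poly D z ^ k = poly q z)"

lemma regular_off_poly: "regular_off D (poly q)"
  unfolding regular_off_def by (rule exI[of _ q], rule exI[of _ 0]) simp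

lemma regular_off_const: "regular_off D (\<lambda>z. c)"
  unfolding regular_off_def by (rule exI[of _ "[:c:]"], rule exI[of _ 0]) simp

lemma regular_off_ident: "regular_off D (\<lambda>z. z)"
  unfolding regular_off_def by (rule exI[of _ "[:0, 1:]"], rule exI[of _ 0]) simp

lemma regular_off_add:
  assumes "regular_off D f" "regular_off D g"
  shows "regular_off D (\<lambda>z. f z + g z)"
proof -
  obtain q k r l where "\<And>z. poly D z \<noteq> 0 \<Longrightarrow> f z * poly D z ^ k = poly q z"
    "\<And>z. poly D z \<noteq> 0 \<Longrightarrow> g z * poly D z ^ l = poly r z"
    using assms unfolding regular_off_def by blast
  note eqs = this
  have "(f z + g z) * poly D z ^ (k + l) = poly (q * D ^ l + r * D ^ k) z"
    if z: "poly D z \<noteq> 0" for z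
  proof -
    have "(f z + g z) * poly D z ^ (k + l) =
        (f z * poly D z ^ k) * poly D z ^ l + (g z * poly D z ^ l) * poly D z ^ k"
      by (simp add: power_add algebra_simps)
    then show ?thesis unfolding eqs(1)[OF z] eqs(2)[OF z] by simp
  qed
  then show ?thesis unfolding regular_off_def by blast
qed

lemma regular_off_mult:
  assumes "regular_off D f" "regular_off D g"
  shows "regular_off D (\<lambda>z. f z * g z)"
proof -
  obtain q k r l where "\<And>z. poly D z \<noteq> 0 \<Longrightarrow> f z * poly D z ^ k = poly q z"
    "\<And>z. poly D z \<noteq> 0 \<Longrightarrow> g z * poly D z ^ l = poly r z"
    using assms unfolding regular_off_def by blast
  note eqs = this
  have "(f z * g z) * poly D z ^ (k + l) = poly (q * r) z"
    if z: "poly D z \<noteq> 0" for z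
  proof -
    have "(f z * g z) * poly D z ^ (k + l) = (f z * poly D z ^ k) * (g z * poly D z ^ l)"
      by (simp add: power_add algebra_simps)
    then show ?thesis unfolding eqs(1)[OF z] eqs(2)[OF z] by simp
  qed
  then show ?thesis unfolding regular_off_def by blast
qed

lemma regular_off_sum:
  "(\<And>i. i \<in> I \<Longrightarrow> regular_off D (f i)) \<Longrightarrow> regular_off D (\<lambda>z. \<Sum>i\<in>I. f i z)"
  by (induction I rule: infinite_finite_induct)
     (auto intro: regular_off_add regular_off_const)

lemma regular_off_weaken: "regular_off 1 f \<Longrightarrow> regular_off D f"
  unfolding regular_off_def by (elim exE, rule_tac x = q in exI, rule_tac x = 0 in exI) simp

lemma regular_off_inverse:
  assumes "d dvd D"
  shows "regular_off D (\<lambda>z. 1 / poly d z)"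
proof -
  obtain e where D: "D = d * e" using assms by (rule dvdE)
  have "\<forall>z. poly D z \<noteq> 0 \<longrightarrow> 1 / poly d z * poly D z ^ 1 = poly e z"
    by (simp add: D)
  then show ?thesis unfolding regular_off_def by blast
qed

text \<open>
  The numerator of \<open>f\<close> vanishes at all real points where \<open>D\<close> does not, hence at infinitely many points.
\<close>

lemma regular_off_identity:
  assumes f: "regular_off D f" and real: "\<And>t. poly D (of_real t) \<noteq> 0 \<Longrightarrow> f (of_real t) = 0"
    and z: "poly D z \<noteq> 0"
  shows "f z = 0"
proof -
  obtain q k where q: "\<And>z. poly D z \<noteq> 0 \<Longrightarrow> f z * poly D z ^ k = poly q z"
    using f unfolding regular_off_def by blast
  have "D \<noteq> 0" using z by auto
  have "q = 0"
  proof (rule ccontr)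
    assume "q \<noteq> 0"
    then have "finite {z. poly (q * D) z = 0}"
      using \<open>D \<noteq> 0\<close> by (intro poly_roots_finite) simp
    moreover have "range complex_of_real \<subseteq> {z. poly (q * D) z = 0}"
      using q real by force
    ultimately have "finite (range complex_of_real)" by (rule finite_subset[rotated])
    then have "finite (UNIV :: real set)"
      by (rule finite_imageD) (simp add: inj_on_def)
    then show False by (simp add: infinite_UNIV_char_0)
  qed
  then show ?thesis using q[OF z] z by simp
qed

definition regular_mat :: "complex poly \<Rightarrow> nat \<Rightarrow> (complex \<Rightarrow> complex mat) \<Rightarrow> bool" where
  "regular_mat D n F \<longleftrightarrow> (\<forall>z. F z \<in> carrier_mat n n) \<and>
    (\<forall>i<n. \<forall>j<n. regular_off D (\<lambda>z. F z $$ (i, j)))"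

lemma regular_mat_carrier: "regular_mat D n F \<Longrightarrow> F z \<in> carrier_mat n n"
  unfolding regular_mat_def by blast

lemma regular_mat_const: "A \<in> carrier_mat n n \<Longrightarrow> regular_mat D n (\<lambda>z. A)"
  unfolding regular_mat_def by (auto intro: regular_off_const)

lemma regular_mat_weaken: "regular_mat 1 n F \<Longrightarrow> regular_mat D n F"
  unfolding regular_mat_def by (auto intro: regular_off_weaken)

lemma regular_mat_add:
  assumes "regular_mat D n F" "regular_mat D n G"
  shows "regular_mat D n (\<lambda>z. F z + G z)"
proof -
  have [simp]: "dim_row (G z) = n" "dim_col (G z) = n" for z
    using regular_mat_carrier[OF assms(2), of z] by auto
  show ?thesis using assms unfolding regular_mat_def by (auto intro!: regular_off_add)
qed

lemma regular_mat_smult: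
  assumes "regular_off D c" "regular_mat D n F"
  shows "regular_mat D n (\<lambda>z. c z \<cdot>\<^sub>m F z)"
proof -
  have [simp]: "dim_row (F z) = n" "dim_col (F z) = n" for z
    using regular_mat_carrier[OF assms(2), of z] by auto
  show ?thesis using assms unfolding regular_mat_def by (auto intro!: regular_off_mult)
qed

lemma regular_mat_minus:
  assumes "regular_mat D n F" "regular_mat D n G"
  shows "regular_mat D n (\<lambda>z. F z - G z)"
proof -
  have [simp]: "dim_row (G z) = n" "dim_col (G z) = n" for z
    using regular_mat_carrier[OF assms(2), of z] by auto
  have "regular_off D (\<lambda>z. F z $$ (i, j) + (-1) * G z $$ (i, j))" if "i < n" "j < n" for i j
    using assms that unfolding regular_mat_def
    by (intro regular_off_add regular_off_mult regular_off_const) auto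
  then show ?thesis using assms unfolding regular_mat_def by auto
qed

lemma regular_mat_mult:
  assumes "regular_mat D n F" "regular_mat D n G"
  shows "regular_mat D n (\<lambda>z. F z * G z)"
proof -
  note c = regular_mat_carrier[OF assms(1)] regular_mat_carrier[OF assms(2)]
  have "regular_off D (\<lambda>z. (F z * G z) $$ (i, j))" if "i < n" "j < n" for i j
    unfolding mult_mat_entry[OF c that]
    using assms that unfolding regular_mat_def
    by (intro regular_off_sum regular_off_mult) auto
  then show ?thesis using c unfolding regular_mat_def by (auto intro!: mult_carrier_mat)
qed

lemma regular_mat_sum:
  assumes "\<And>i. i \<in> I \<Longrightarrow> regular_mat D n (F i)"
  shows "regular_mat D n (\<lambda>z. mat_sum n (\<lambda>i. F i z) I)"
  using assms unfolding regular_mat_def by (auto intro!: regular_off_sum)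

text \<open>
  The adjugate of the matrix, taken over the polynomial ring and then evaluated.
\<close>

lemma regular_mat_adjugate:
  assumes F: "regular_mat 1 n F"
  shows "\<exists>G d. regular_mat 1 n G \<and> (\<forall>z. poly d z = det (F z) \<and>
    F z * G z = poly d z \<cdot>\<^sub>m 1\<^sub>m n \<and> G z * F z = poly d z \<cdot>\<^sub>m 1\<^sub>m n)"
proof -
  have "\<exists>q. \<forall>z. F z $$ (i, j) = poly q z" if "i < n" "j < n" for i j
    using F that unfolding regular_mat_def regular_off_def by simp
  then obtain q where q: "\<And>i j z. i < n \<Longrightarrow> j < n \<Longrightarrow> F z $$ (i, j) = poly (q i j) z"
    by metis
  define P where "P = mat n n (\<lambda>(i, j). q i j)"
  have P: "P \<in> carrier_mat n n" unfolding P_def by simp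
  have FP: "F z = map_mat (\<lambda>p. poly p z) P" for z
    unfolding P_def using q regular_mat_carrier[OF F, of z] by (intro eq_matI) auto
  define G where "G z = map_mat (\<lambda>p. poly p z) (adj_mat P)" for z
  note adj = adj_mat[OF P]
  have hom: "comm_ring_hom (\<lambda>p. poly p z)" for z :: complex by unfold_locales auto
  have shom: "semiring_hom (\<lambda>p. poly p z)" for z :: complex by unfold_locales auto
  have sm: "map_mat (\<lambda>p. poly p z) (det P \<cdot>\<^sub>m 1\<^sub>m n) = poly (det P) z \<cdot>\<^sub>m 1\<^sub>m n" for z :: complex
    by (intro eq_matI) auto
  show ?thesis
  proof (intro exI[of _ G] exI[of _ "det P"] conjI allI)
    show "regular_mat 1 n G"
      unfolding regular_mat_def G_def using adj(1) by (auto intro: regular_off_poly)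
    fix z :: complex
    show "poly (det P) z = det (F z)" unfolding FP by (rule comm_ring_hom.hom_det[OF hom, symmetric])
    show "F z * G z = poly (det P) z \<cdot>\<^sub>m 1\<^sub>m n"
      unfolding FP G_def semiring_hom.mat_hom_mult[OF shom P adj(1), symmetric] adj(2) sm ..
    show "G z * F z = poly (det P) z \<cdot>\<^sub>m 1\<^sub>m n"
      unfolding FP G_def semiring_hom.mat_hom_mult[OF shom adj(1) P, symmetric] adj(3) sm ..
  qed
qed

lemma finite_singular_pencil:
  fixes A :: "complex mat"
  assumes A: "A \<in> carrier_mat n n"
  shows "finite {z. det (1\<^sub>m n - z \<cdot>\<^sub>m A) = 0}"
proof -
  have reg: "regular_mat 1 n (\<lambda>z. 1\<^sub>m n - z \<cdot>\<^sub>m A)"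
    using A by (intro regular_mat_minus regular_mat_smult regular_mat_const regular_off_ident) auto
  obtain G d where "\<forall>z. poly d z = det (1\<^sub>m n - z \<cdot>\<^sub>m A) \<and>
      (1\<^sub>m n - z \<cdot>\<^sub>m A) * G z = poly d z \<cdot>\<^sub>m 1\<^sub>m n \<and>
      G z * (1\<^sub>m n - z \<cdot>\<^sub>m A) = poly d z \<cdot>\<^sub>m 1\<^sub>m n"
    using regular_mat_adjugate[OF reg] by (elim exE conjE)
  then have d: "poly d z = det (1\<^sub>m n - z \<cdot>\<^sub>m A)" for z by simp
  have "1\<^sub>m n - 0 \<cdot>\<^sub>m A = 1\<^sub>m n" using A by (intro eq_matI) auto
  then have "poly d 0 = 1" using d[of 0] by simp
  then have "d \<noteq> 0" by auto
  then show ?thesis using poly_roots_finite[of d] by (simp add: d)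
qed

lemma infinite_unit_circle: "infinite {z :: complex. cmod z = 1}"
proof
  assume f: "finite {z :: complex. cmod z = 1}"
  let ?N = "Suc (card {z :: complex. cmod z = 1})"
  have "{z :: complex. z ^ ?N = 1} \<subseteq> {z. cmod z = 1}"
  proof safe
    fix z :: complex assume "z ^ ?N = 1"
    then have "cmod z ^ ?N = 1 ^ ?N" by (metis norm_power norm_one power_one)
    then show "cmod z = 1" by (rule power_eq_imp_eq_base) auto
  qed
  then have "card {z :: complex. z ^ ?N = 1} \<le> card {z :: complex. cmod z = 1}"
    using f by (intro card_mono)
  then show False using card_roots_unity_eq[of ?N] by simp
qed

text \<open>
  The Cayley coordinates below require \<open>1 - X\<^sub>1\<close> and \<open>1 - Y\<^sub>1\<close> to be invertible. Multiplying \<open>X\<^sub>1\<close> by a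
  phase and \<open>Y\<^sub>1\<close> by its conjugate preserves both the relation and the isometries, and only
  finitely many phases fail.
\<close>

lemma unit_phase_nonsingular:
  fixes A B :: "complex mat"
  assumes A: "A \<in> carrier_mat n n" and B: "B \<in> carrier_mat n n"
  obtains w where "w * cnj w = 1" "det (1\<^sub>m n - w \<cdot>\<^sub>m A) \<noteq> 0" "det (1\<^sub>m n - cnj w \<cdot>\<^sub>m B) \<noteq> 0"
proof -
  let ?S = "{z. det (1\<^sub>m n - z \<cdot>\<^sub>m A) = 0} \<union> cnj ` {z. det (1\<^sub>m n - z \<cdot>\<^sub>m B) = 0}"
  have "finite ?S" using finite_singular_pencil[OF A] finite_singular_pencil[OF B] by simp
  then have "infinite ({z. cmod z = 1} - ?S)" using infinite_unit_circle by (rule Diff_infinite_finite)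
  then obtain w where w: "cmod w = 1" "w \<notin> ?S" using infinite_imp_nonempty by blast
  show thesis
  proof (rule that[of w])
    show "w * cnj w = 1" using complex_norm_square[of w] w(1) by simp
    show "det (1\<^sub>m n - w \<cdot>\<^sub>m A) \<noteq> 0" using w(2) by simp
    show "det (1\<^sub>m n - cnj w \<cdot>\<^sub>m B) \<noteq> 0" using w(2) by (auto simp: image_iff)
  qed
qed

section \<open>Cayley coordinates for left-invertible columns\<close>

lemma mat_sandwich_add:
  assumes "A \<in> carrier_mat n n" "U \<in> carrier_mat n n" "V \<in> carrier_mat n n" "C \<in> carrier_mat n n"
  shows "A * (U + V) * C = A * U * C + A * V * C"
  using assms by (simp add: mult_add_distrib_mat[of A n n U n V] add_mult_distrib_mat[of "A * U" n n "A * V" C n])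

lemma one_minus_mult_one_minus:
  fixes A B :: "complex mat"
  assumes A: "A \<in> carrier_mat n n" and B: "B \<in> carrier_mat n n"
  shows "(1\<^sub>m n - A) * (1\<^sub>m n - B) = 1\<^sub>m n - A - B + A * B"
proof -
  have "(1\<^sub>m n - A) * (1\<^sub>m n - B) = (1\<^sub>m n - B) - (A - A * B)"
    using A B by (simp add: minus_mult_distrib_mat[of "1\<^sub>m n" n n A "1\<^sub>m n - B" n]
        mult_minus_distrib_mat[of A n n "1\<^sub>m n" n B] minus_carrier_mat)
  also have "\<dots> = 1\<^sub>m n - A - B + A * B"
    using A B mult_carrier_mat[OF A B] by (intro eq_matI) (auto simp del: index_mult_mat(1))
  finally show ?thesis .
qed

lemma mat_sum_sandwich:
  assumes A: "A \<in> carrier_mat n n" and C: "C \<in> carrier_mat n n"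
    and S: "\<And>j. j \<in> J \<Longrightarrow> S j \<in> carrier_mat n n" and T: "\<And>j. j \<in> J \<Longrightarrow> T j \<in> carrier_mat n n"
  shows "mat_sum n (\<lambda>j. (A * S j) * (T j * C)) J = A * mat_sum n (\<lambda>j. S j * T j) J * C"
proof -
  have "(A * S j) * (T j * C) = A * (S j * T j) * C" if "j \<in> J" for j
  proof -
    have SC: "T j * C \<in> carrier_mat n n" "S j * T j \<in> carrier_mat n n" using C by (auto intro!: mult_carrier_mat S[OF that] T[OF that])
    have "(A * S j) * (T j * C) = A * (S j * (T j * C))"
      by (rule assoc_mult_mat[OF A S[OF that] SC(1)])
    also have "S j * (T j * C) = S j * T j * C"
      by (rule assoc_mult_mat[OF S[OF that] T[OF that] C, symmetric])
    also have "A * (S j * T j * C) = A * (S j * T j) * C"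
      by (rule assoc_mult_mat[OF A SC(2) C, symmetric])
    finally show ?thesis .
  qed
  then have "mat_sum n (\<lambda>j. (A * S j) * (T j * C)) J = mat_sum n (\<lambda>j. A * (S j * T j) * C) J"
    by (rule mat_sum_cong)
  also have "\<dots> = mat_sum n (\<lambda>j. A * (S j * T j)) J * C"
    using A C S T by (intro mat_sum_mult[symmetric] mult_carrier_mat) auto
  also have "mat_sum n (\<lambda>j. A * (S j * T j)) J = A * mat_sum n (\<lambda>j. S j * T j) J"
    using A S T by (intro mult_mat_sum[symmetric] mult_carrier_mat) auto
  finally show ?thesis .
qed

lemma mat_sandwich_inverse_sum:
  fixes N N' L L' :: "complex mat"
  assumes c: "N \<in> carrier_mat n n" "N' \<in> carrier_mat n n" "L \<in> carrier_mat n n" "L' \<in> carrier_mat n n"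
    and inv: "L * N = 1\<^sub>m n" "N' * L' = 1\<^sub>m n"
  shows "N' * (L' + L) * N = N + N'"
proof -
  have "N' * L * N = N' * (L * N)" using c by (intro assoc_mult_mat) auto
  then show ?thesis
    using c inv left_mult_one_mat[OF c(1)] right_mult_one_mat[OF c(2)]
    by (simp add: mat_sandwich_add[of N' n])
qed

text \<open>
  This lemma and its converse are the Cayley coordinates: with \<open>X\<^sub>1 = 1 - N\<close>, \<open>Y\<^sub>1 = 1 - N'\<close>, and for the
  other indices \<open>X\<^sub>j = T\<^sub>j N\<close>, \<open>Y\<^sub>j = N' S\<^sub>j\<close>, the relation \<open>\<Sum>\<^sub>j Y\<^sub>j X\<^sub>j = 1\<close> reads
  \<open>N + N' = N' N + N' (\<Sum>\<^sub>j S\<^sub>j T\<^sub>j) N\<close>. Multiplying by the inverses \<open>L'\<close> of \<open>N'\<close> on the left and \<open>L\<close> of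
  \<open>N\<close> on the right turns it into the equation \<open>L' + L = 1 + \<Sum>\<^sub>j S\<^sub>j T\<^sub>j\<close>, which is linear in \<open>L\<close>
  and \<open>L'\<close> and so is easy to satisfy along a curve.
\<close>

lemma cayley_imp_left_inverse:
  fixes N N' L L' :: "complex mat"
  assumes c: "N \<in> carrier_mat n n" "N' \<in> carrier_mat n n" "L \<in> carrier_mat n n" "L' \<in> carrier_mat n n"
    and S: "\<And>j. j \<in> J \<Longrightarrow> S j \<in> carrier_mat n n" and T: "\<And>j. j \<in> J \<Longrightarrow> T j \<in> carrier_mat n n"
    and inv: "L * N = 1\<^sub>m n" "N' * L' = 1\<^sub>m n"
    and eq: "L' + L = 1\<^sub>m n + mat_sum n (\<lambda>j. S j * T j) J"
  shows "(1\<^sub>m n - N') * (1\<^sub>m n - N) + mat_sum n (\<lambda>j. (N' * S j) * (T j * N)) J = 1\<^sub>m n"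
proof -
  let ?R = "mat_sum n (\<lambda>j. S j * T j) J"
  have "N' * N + N' * ?R * N = N' * (L' + L) * N"
    unfolding eq using c by (simp add: mat_sandwich_add[of N' n])
  then have *: "N' * N + N' * ?R * N = N + N'"
    using mat_sandwich_inverse_sum[OF c inv] by simp
  have PQ: "N' * N \<in> carrier_mat n n" "N' * ?R * N \<in> carrier_mat n n"
    using c by (auto intro!: mult_carrier_mat)
  have ent: "(N' * N) $$ (i, j) + (N' * ?R * N) $$ (i, j) = N $$ (i, j) + N' $$ (i, j)"
    if "i < n" "j < n" for i j
    using arg_cong[OF *, of "\<lambda>A. A $$ (i, j)"] PQ c that
    by (simp del: index_mult_mat(1))
  have sw: "mat_sum n (\<lambda>j. (N' * S j) * (T j * N)) J = N' * ?R * N"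
    by (rule mat_sum_sandwich[OF c(2,1)]) (use S T in auto)
  show ?thesis
    unfolding sw one_minus_mult_one_minus[OF c(2,1)]
  proof (rule eq_matI)
    fix i j assume "i < dim_row (1\<^sub>m n)" "j < dim_col (1\<^sub>m n)"
    then have ij: "i < n" "j < n" by auto
    show "(1\<^sub>m n - N' - N + N' * N + N' * ?R * N) $$ (i, j) = 1\<^sub>m n $$ (i, j)"
      using ent[OF ij] PQ c ij by (simp del: index_mult_mat(1) add: algebra_simps)
  qed (use PQ c in auto)
qed

lemma left_inverse_imp_cayley:
  fixes N N' L L' :: "complex mat"
  assumes c: "N \<in> carrier_mat n n" "N' \<in> carrier_mat n n" "L \<in> carrier_mat n n" "L' \<in> carrier_mat n n"
    and S: "\<And>j. j \<in> J \<Longrightarrow> S j \<in> carrier_mat n n" and T: "\<And>j. j \<in> J \<Longrightarrow> T j \<in> carrier_mat n n"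
    and inv: "N * L = 1\<^sub>m n" "L' * N' = 1\<^sub>m n"
    and eq: "(1\<^sub>m n - N') * (1\<^sub>m n - N) + mat_sum n (\<lambda>j. S j * T j) J = 1\<^sub>m n"
  shows "L' + L = 1\<^sub>m n + mat_sum n (\<lambda>j. (L' * S j) * (T j * L)) J"
proof -
  let ?R = "mat_sum n (\<lambda>j. S j * T j) J"
  have PQ: "N' * N \<in> carrier_mat n n" using c by (auto intro!: mult_carrier_mat)
  have "N' + N = N' * N + ?R"
  proof (rule eq_matI)
    fix i j assume "i < dim_row (N' * N + ?R)" "j < dim_col (N' * N + ?R)"
    then have ij: "i < n" "j < n" by auto
    then show "(N' + N) $$ (i, j) = (N' * N + ?R) $$ (i, j)"
      using arg_cong[OF eq[unfolded one_minus_mult_one_minus[OF c(2,1)]], of "\<lambda>A. A $$ (i, j)"] PQ c ij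
      by (simp del: index_mult_mat(1) mat_sum_entry add: algebra_simps)
  qed (use PQ c in auto)
  then have "L' * (N' + N) * L = L' * (N' * N) * L + L' * ?R * L"
    using c PQ by (simp add: mat_sandwich_add[of L' n])
  also have "L' * (N' * N) * L = (L' * N') * N * L"
    using c by (simp add: assoc_mult_mat[of L' n n N' n N n])
  also have "\<dots> = 1\<^sub>m n" using c inv by simp
  also have "L' * (N' + N) * L = L + L'"
    by (rule mat_sandwich_inverse_sum[OF c(3,4,1,2) inv])
  also have "L + L' = L' + L" using c by (intro comm_add_mat) auto
  also have "L' * ?R * L = mat_sum n (\<lambda>j. (L' * S j) * (T j * L)) J"
    by (rule mat_sum_sandwich[OF c(4,3), symmetric]) (use S T in auto)
  finally show ?thesis .
qed

section \<open>Curves that are adjoint at real times\<close>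

text \<open>
  The affine curve through \<open>Z\<close> at time \<open>\<i>\<close> whose adjoint at real times is the curve through \<open>W\<close>: it is
  \<open>P + z Q\<close> for the decompositions \<open>Z = P + \<i> Q\<close> and \<open>W = P\<^sup>* + \<i> Q\<^sup>*\<close>.
\<close>

definition adjoint_curve :: "complex mat \<Rightarrow> complex mat \<Rightarrow> complex \<Rightarrow> complex mat" where
  "adjoint_curve Z W z =
     (1 / 2) \<cdot>\<^sub>m (Z + mat_adjoint W) + (z / (2 * \<i>)) \<cdot>\<^sub>m (Z - mat_adjoint W)"

lemma adjoint_curve_carrier [simp]:
  "Z \<in> carrier_mat n n \<Longrightarrow> W \<in> carrier_mat n n \<Longrightarrow> adjoint_curve Z W z \<in> carrier_mat n n"
  unfolding adjoint_curve_def by (simp add: minus_carrier_mat)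

lemma adjoint_curve_entry:
  assumes "Z \<in> carrier_mat n n" "W \<in> carrier_mat n n" "i < n" "j < n"
  shows "adjoint_curve Z W z $$ (i, j) =
    (Z $$ (i, j) + cnj (W $$ (j, i))) / 2 + z * (Z $$ (i, j) - cnj (W $$ (j, i))) / (2 * \<i>)"
  using assms carrier_matD[OF mat_adjoint_carrier[OF assms(2)]]
  unfolding adjoint_curve_def by (simp add: mat_adjoint_entry minus_carrier_mat)

lemma adjoint_curve_ii:
  assumes "Z \<in> carrier_mat n n" "W \<in> carrier_mat n n"
  shows "adjoint_curve Z W \<i> = Z"
proof (rule eq_matI)
  fix i j assume "i < dim_row Z" "j < dim_col Z"
  then show "adjoint_curve Z W \<i> $$ (i, j) = Z $$ (i, j)"
    using assms by (simp add: adjoint_curve_entry[OF assms] field_simps)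
qed (use assms carrier_matD[OF adjoint_curve_carrier[OF assms, of \<i>]] in auto)

lemma mat_adjoint_adjoint_curve:
  assumes "Z \<in> carrier_mat n n" "W \<in> carrier_mat n n"
  shows "mat_adjoint (adjoint_curve Z W (of_real t)) = adjoint_curve W Z (of_real t)"
proof (rule eq_matI)
  fix i j assume "i < dim_row (adjoint_curve W Z (of_real t))" "j < dim_col (adjoint_curve W Z (of_real t))"
  then have ij: "i < n" "j < n" using adjoint_curve_carrier[OF assms(2,1), of "of_real t"] by auto
  show "mat_adjoint (adjoint_curve Z W (of_real t)) $$ (i, j) = adjoint_curve W Z (of_real t) $$ (i, j)"
    unfolding mat_adjoint_entry[OF adjoint_curve_carrier[OF assms] ij]
      adjoint_curve_entry[OF assms ij(2,1)] adjoint_curve_entry[OF assms(2,1) ij]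
    by (simp add: field_simps)
qed (use adjoint_curve_carrier[OF assms(2,1), of "of_real t"]
      mat_adjoint_carrier[OF adjoint_curve_carrier[OF assms, of "of_real t"]] in auto)

lemma regular_mat_adjoint_curve:
  assumes "Z \<in> carrier_mat n n" "W \<in> carrier_mat n n"
  shows "regular_mat D n (adjoint_curve Z W)"
proof -
  have "regular_off D (\<lambda>z. z * (1 / (2 * \<i>)))"
    by (rule regular_off_mult[OF regular_off_ident regular_off_const])
  then have "regular_off D (\<lambda>z. z / (2 * \<i>))"
    unfolding times_divide_eq_right mult_1_right .
  moreover have "regular_off D (\<lambda>z. 1 / 2)" by (rule regular_off_const)
  ultimately have "regular_mat D n (\<lambda>z. (1 / 2) \<cdot>\<^sub>m (Z + mat_adjoint W) + (z / (2 * \<i>)) \<cdot>\<^sub>m (Z - mat_adjoint W))"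
    using assms by (intro regular_mat_add regular_mat_smult regular_mat_const regular_mat_minus) auto
  then show ?thesis by (simp add: adjoint_curve_def[abs_def])
qed

section \<open>Spherical isometries determine the values at all left-invertible columns\<close>

text \<open>
  Evaluation at independent values for the letters \<open>X j\<close> and \<open>XT j\<close>, that is, without the constraint that
  the latter be adjoints of the former.
\<close>

definition free_eval :: "nat \<Rightarrow> ('g letter \<Rightarrow> complex mat) \<Rightarrow> 'g ncpoly \<Rightarrow> complex mat" where
  "free_eval n B p = mat_sum n
     (\<lambda>w. Poly_Mapping.lookup p w \<cdot>\<^sub>m foldr (\<lambda>l M. B l * M) (letters w) (1\<^sub>m n)) (Poly_Mapping.keys p)"

lemma nc_eval_eq_free_eval: "nc_eval n A p = free_eval n (letter_eval A) p"
  by (simp add: nc_eval_def free_eval_def word_eval_def)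

lemma regular_mat_free_eval:
  assumes "\<And>l. regular_mat D n (\<lambda>z. B z l)"
  shows "regular_mat D n (\<lambda>z. free_eval n (B z) p)"
proof -
  have "regular_mat D n (\<lambda>z. foldr (\<lambda>l M. B z l * M) ls (1\<^sub>m n))" for ls
    by (induction ls) (auto intro: regular_mat_const regular_mat_mult assms)
  then show ?thesis
    unfolding free_eval_def by (intro regular_mat_sum regular_mat_smult regular_off_const)
qed

text \<open>
  Passing from isometries to arbitrary pairs with \<open>\<Sum>\<^sub>j Y\<^sub>j X\<^sub>j = 1\<close>. The Cayley parameters of the given
  pair are moved along adjoint curves: \<open>S\<^sub>j\<close> and \<open>T\<^sub>j\<close> become adjoint to each other at real
  times, and so do \<open>L\<close> and \<open>L'\<close> once they are written as one half of \<open>1 + \<Sum>\<^sub>j S\<^sub>j T\<^sub>j\<close> plus one half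
  of \<open>L - L'\<close> and of \<open>L' - L\<close>, respectively. Wherever the moved \<open>L\<close> and \<open>L'\<close> are invertible, the
  inverse coordinates give a pair satisfying the relation, which at real times is an isometry and its
  adjoint.
\<close>

lemma free_eval_eq_0_of_isometries:
  fixes B :: "'g::finite letter \<Rightarrow> complex mat"
  assumes vanish: "\<And>A :: 'g \<Rightarrow> complex mat. spherical_isometry n A \<Longrightarrow> nc_eval n A p = 0\<^sub>m n n"
    and B: "\<And>l. B l \<in> carrier_mat n n"
    and inv: "mat_sum n (\<lambda>j. B (XT j) * B (X j)) UNIV = 1\<^sub>m n"
  shows "free_eval n B p = 0\<^sub>m n n"
proof -
  \<comment> \<open>any index may be distinguished; its letters are the ones given by the Cayley transform\<close>
  define j0 :: 'g where "j0 = undefined"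
  define J where "J = UNIV - {j0}"
  obtain w where w: "w * cnj w = 1"
    and det: "det (1\<^sub>m n - w \<cdot>\<^sub>m B (X j0)) \<noteq> 0" "det (1\<^sub>m n - cnj w \<cdot>\<^sub>m B (XT j0)) \<noteq> 0"
    by (rule unit_phase_nonsingular[OF B B])
  have w': "cnj w * cnj (cnj w) = 1" using w by (simp add: mult.commute)
  define N where "N = 1\<^sub>m n - w \<cdot>\<^sub>m B (X j0)"
  define N' where "N' = 1\<^sub>m n - cnj w \<cdot>\<^sub>m B (XT j0)"
  have N: "N \<in> carrier_mat n n" "N' \<in> carrier_mat n n"
    unfolding N_def N'_def using B by (simp_all add: minus_carrier_mat)
  obtain L where L: "L \<in> carrier_mat n n" "L * N = 1\<^sub>m n" "N * L = 1\<^sub>m n"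
    by (rule mat_inverse_exists[OF N(1) det(1)[folded N_def]])
  obtain L' where L': "L' \<in> carrier_mat n n" "L' * N' = 1\<^sub>m n" "N' * L' = 1\<^sub>m n"
    by (rule mat_inverse_exists[OF N(2) det(2)[folded N'_def]])
  define T where "T j = B (X j) * L" for j
  define S where "S j = L' * B (XT j)" for j
  have T: "T j \<in> carrier_mat n n" and S: "S j \<in> carrier_mat n n" for j
    unfolding T_def S_def using B L(1) L'(1) by (auto intro!: mult_carrier_mat)
  have "mat_sum n (\<lambda>j. B (XT j) * B (X j)) UNIV =
      B (XT j0) * B (X j0) + mat_sum n (\<lambda>j. B (XT j) * B (X j)) J"
    unfolding J_def by (rule mat_sum_remove) (auto intro!: mult_carrier_mat B)
  moreover have "(1\<^sub>m n - N') * (1\<^sub>m n - N) = B (XT j0) * B (X j0)"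
  proof -
    have "1\<^sub>m n - N' = cnj w \<cdot>\<^sub>m B (XT j0)" "1\<^sub>m n - N = w \<cdot>\<^sub>m B (X j0)"
      unfolding N_def N'_def using B[of "X j0"] B[of "XT j0"] by (auto intro!: eq_matI)
    then show ?thesis using smult_mult_smult_phase[OF w' B B] by simp
  qed
  ultimately have "(1\<^sub>m n - N') * (1\<^sub>m n - N) + mat_sum n (\<lambda>j. B (XT j) * B (X j)) J = 1\<^sub>m n"
    using inv by simp
  from left_inverse_imp_cayley[OF N L(1) L'(1) B B L(3) L'(2) this]
  have LL: "L' + L = 1\<^sub>m n + mat_sum n (\<lambda>j. S j * T j) J" unfolding S_def T_def .
  \<comment> \<open>the curves: \<open>P\<close> and \<open>P'\<close> pass through \<open>L\<close> and \<open>L'\<close> at time \<open>\<i>\<close> and satisfy the same linear relation at all times\<close>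
  define R where "R z = mat_sum n (\<lambda>j. adjoint_curve (S j) (T j) z * adjoint_curve (T j) (S j) z) J" for z
  have Rc: "R z \<in> carrier_mat n n" for z unfolding R_def by simp
  have Dc: "L - L' \<in> carrier_mat n n" "L' - L \<in> carrier_mat n n"
    using L(1) L'(1) by (simp_all add: minus_carrier_mat)
  define P where "P z = (1 / 2) \<cdot>\<^sub>m (1\<^sub>m n + R z + adjoint_curve (L - L') (L' - L) z)" for z
  define P' where "P' z = (1 / 2) \<cdot>\<^sub>m (1\<^sub>m n + R z + adjoint_curve (L' - L) (L - L') z)" for z
  note cc = adjoint_curve_carrier[OF Dc] adjoint_curve_carrier[OF Dc(2,1)]
  have Pc: "P z \<in> carrier_mat n n" "P' z \<in> carrier_mat n n" for z
    unfolding P_def P'_def using Rc[of z] cc[of z] by (auto intro!: add_carrier_mat)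
  have PP: "P' z + P z = 1\<^sub>m n + R z" for z
  proof (rule eq_matI)
    fix i j assume "i < dim_row (1\<^sub>m n + R z)" "j < dim_col (1\<^sub>m n + R z)"
    then have ij: "i < n" "j < n" using Rc[of z] by auto
    then show "(P' z + P z) $$ (i, j) = (1\<^sub>m n + R z) $$ (i, j)"
      unfolding P_def P'_def using carrier_matD[OF Rc[of z]] carrier_matD[OF cc(1)[of z]]
        carrier_matD[OF cc(2)[of z]] L(1) L'(1)
      by (simp add: adjoint_curve_entry[OF Dc ij] adjoint_curve_entry[OF Dc(2,1) ij] field_simps)
  qed (use Rc[of z] Pc[of z] in auto)
  have "R \<i> = mat_sum n (\<lambda>j. S j * T j) J"
    unfolding R_def by (intro mat_sum_cong) (simp add: adjoint_curve_ii[OF S T] adjoint_curve_ii[OF T S])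
  then have Ri: "1\<^sub>m n + R \<i> = L' + L" using LL by simp
  have Pi: "P \<i> = L" "P' \<i> = L'"
    unfolding P_def P'_def Ri adjoint_curve_ii[OF Dc] adjoint_curve_ii[OF Dc(2,1)]
    using L(1) L'(1) by (auto intro!: eq_matI)
  have regR: "regular_mat D n R" for D
    unfolding R_def by (intro regular_mat_sum regular_mat_mult regular_mat_adjoint_curve S T)
  have regP: "regular_mat D n P" "regular_mat D n P'" for D
    unfolding P_def P'_def
    by (intro regular_mat_smult regular_off_const regular_mat_add regular_mat_const one_carrier_mat
        regR regular_mat_adjoint_curve Dc)+
  obtain G d where G: "regular_mat 1 n G" and d: "\<forall>z. poly d z = det (P z) \<and>
      P z * G z = poly d z \<cdot>\<^sub>m 1\<^sub>m n \<and> G z * P z = poly d z \<cdot>\<^sub>m 1\<^sub>m n"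
    using regular_mat_adjugate[OF regP(1)] by (elim exE conjE)
  obtain G' d' where G': "regular_mat 1 n G'" and d': "\<forall>z. poly d' z = det (P' z) \<and>
      P' z * G' z = poly d' z \<cdot>\<^sub>m 1\<^sub>m n \<and> G' z * P' z = poly d' z \<cdot>\<^sub>m 1\<^sub>m n"
    using regular_mat_adjugate[OF regP(2)] by (elim exE conjE)
  note Gc = regular_mat_carrier[OF G] regular_mat_carrier[OF G']
  define D where "D = d * d'"
  define Q where "Q z = (1 / poly d z) \<cdot>\<^sub>m G z" for z
  define Q' where "Q' z = (1 / poly d' z) \<cdot>\<^sub>m G' z" for z
  have Qc: "Q z \<in> carrier_mat n n" "Q' z \<in> carrier_mat n n" for z
    unfolding Q_def Q'_def using Gc by simp_all
  have PQ: "P z * Q z = 1\<^sub>m n" "Q z * P z = 1\<^sub>m n" "P' z * Q' z = 1\<^sub>m n" "Q' z * P' z = 1\<^sub>m n"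
    if "poly D z \<noteq> 0" for z
  proof -
    have nz: "poly d z \<noteq> 0" "poly d' z \<noteq> 0" using that unfolding D_def by auto
    show "P z * Q z = 1\<^sub>m n" "Q z * P z = 1\<^sub>m n"
      unfolding Q_def using mat_inverse_from_scalar[OF Pc(1) Gc(1) nz(1)] d by blast+
    show "P' z * Q' z = 1\<^sub>m n" "Q' z * P' z = 1\<^sub>m n"
      unfolding Q'_def using mat_inverse_from_scalar[OF Pc(2) Gc(2) nz(2)] d' by blast+
  qed
  have regQ: "regular_mat D n Q" "regular_mat D n Q'"
    unfolding Q_def Q'_def
    by (rule regular_mat_smult[OF regular_off_inverse regular_mat_weaken[OF G]], simp add: D_def,
        rule regular_mat_smult[OF regular_off_inverse regular_mat_weaken[OF G']], simp add: D_def)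
  \<comment> \<open>back from the parameters to the values of the letters, undoing the change of phase\<close>
  define C where "C z l = (case l of
      X j \<Rightarrow> if j = j0 then cnj w \<cdot>\<^sub>m (1\<^sub>m n - Q z) else adjoint_curve (T j) (S j) z * Q z
    | XT j \<Rightarrow> if j = j0 then w \<cdot>\<^sub>m (1\<^sub>m n - Q' z) else Q' z * adjoint_curve (S j) (T j) z)" for z l
  have regC: "regular_mat D n (\<lambda>z. C z l)" for l
  proof -
    have "regular_mat D n (\<lambda>z. cnj w \<cdot>\<^sub>m (1\<^sub>m n - Q z))" "regular_mat D n (\<lambda>z. w \<cdot>\<^sub>m (1\<^sub>m n - Q' z))"
      "regular_mat D n (\<lambda>z. adjoint_curve (T j) (S j) z * Q z)"
      "regular_mat D n (\<lambda>z. Q' z * adjoint_curve (S j) (T j) z)" for j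
      by (intro regular_mat_smult regular_mat_mult regular_mat_minus regular_mat_const
          regular_off_const regular_mat_adjoint_curve regQ S T one_carrier_mat)+
    then show ?thesis
      unfolding C_def by (cases l rule: letter.exhaust; cases "l = X j0 \<or> l = XT j0") simp_all
  qed
  have Cc: "C z l \<in> carrier_mat n n" for z l using regular_mat_carrier[OF regC] .
  \<comment> \<open>the given parameters \<open>L\<close> and \<open>L'\<close> are invertible, so time \<open>\<i>\<close> is not a pole\<close>
  have Di: "poly D \<i> \<noteq> 0"
  proof -
    have "det L * det N = 1" using arg_cong[OF L(2), of det] det_mult[OF L(1) N(1)] by simp
    moreover have "det L' * det N' = 1" using arg_cong[OF L'(2), of det] det_mult[OF L'(1) N(2)] by simp
    ultimately show ?thesis unfolding D_def using d d' Pi by auto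
  qed
  have Qi: "Q \<i> = N" "Q' \<i> = N'"
    using mat_inverse_unique[OF L(1) Qc(1) N(1) _ L(2)] PQ(2)[OF Di] Pi(1)
      mat_inverse_unique[OF L'(1) Qc(2) N(2) _ L'(2)] PQ(4)[OF Di] Pi(2) by simp_all
  have Ci: "C \<i> l = B l" for l
  proof (cases l)
    case (X j)
    have "T j * N = B (X j)" unfolding T_def using L B[of "X j"] N
      by (simp add: assoc_mult_mat[of "B (X j)" n n L n N n])
    then show ?thesis unfolding X C_def using phase_cancel(1)[OF w B[of "X j0"]]
      by (simp add: Qi adjoint_curve_ii[OF T S] N_def)
  next
    case (XT j)
    have "N' * S j = B (XT j)" unfolding S_def using L' B[of "XT j"] N
      by (simp add: assoc_mult_mat[of N' n n L' n "B (XT j)" n, symmetric])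
    then show ?thesis unfolding XT C_def using phase_cancel(2)[OF w B[of "XT j0"]]
      by (simp add: Qi adjoint_curve_ii[OF S T] N'_def)
  qed
  have Cinv: "mat_sum n (\<lambda>j. C z (XT j) * C z (X j)) UNIV = 1\<^sub>m n" if z: "poly D z \<noteq> 0" for z
  proof -
    have "mat_sum n (\<lambda>j. C z (XT j) * C z (X j)) UNIV =
        C z (XT j0) * C z (X j0) + mat_sum n (\<lambda>j. C z (XT j) * C z (X j)) J"
      unfolding J_def by (rule mat_sum_remove) (auto intro!: mult_carrier_mat Cc)
    also have "C z (XT j0) * C z (X j0) = (1\<^sub>m n - Q' z) * (1\<^sub>m n - Q z)"
      unfolding C_def using smult_mult_smult_phase[OF w, of "1\<^sub>m n - Q z" n "1\<^sub>m n - Q' z"] Qc[of z]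
      by (simp add: minus_carrier_mat)
    also have "mat_sum n (\<lambda>j. C z (XT j) * C z (X j)) J = mat_sum n (\<lambda>j.
        (Q' z * adjoint_curve (S j) (T j) z) * (adjoint_curve (T j) (S j) z * Q z)) J"
      by (rule mat_sum_cong) (simp add: C_def J_def)
    also have "(1\<^sub>m n - Q' z) * (1\<^sub>m n - Q z) + \<dots> = 1\<^sub>m n"
      by (rule cayley_imp_left_inverse[OF Qc Pc adjoint_curve_carrier[OF S T]
            adjoint_curve_carrier[OF T S] PQ(1)[OF z] PQ(4)[OF z] PP[unfolded R_def]])
    finally show ?thesis .
  qed
  have Pstar: "mat_adjoint (P (of_real t)) = P' (of_real t)" for t
  proof -
    let ?t = "complex_of_real t"
    have "mat_adjoint (R ?t) = R ?t"
      unfolding R_def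
      by (subst mat_adjoint_sum)
         (auto intro!: mat_sum_cong mult_carrier_mat adjoint_curve_carrier S T
           simp: mat_adjoint_mult[OF adjoint_curve_carrier[OF S T] adjoint_curve_carrier[OF T S]]
             mat_adjoint_adjoint_curve[OF S T] mat_adjoint_adjoint_curve[OF T S])
    then have R: "cnj (R ?t $$ (j, i)) = R ?t $$ (i, j)" if "i < n" "j < n" for i j
      using mat_adjoint_entry[OF Rc that] by metis
    show ?thesis
    proof (rule eq_matI)
      fix i j assume "i < dim_row (P' ?t)" "j < dim_col (P' ?t)"
      then have ij: "i < n" "j < n" using Pc[of ?t] by auto
      have "cnj (adjoint_curve (L - L') (L' - L) ?t $$ (j, i)) = adjoint_curve (L' - L) (L - L') ?t $$ (i, j)"
        using mat_adjoint_entry[OF cc(1) ij] mat_adjoint_adjoint_curve[OF Dc] by metis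
      then show "mat_adjoint (P ?t) $$ (i, j) = P' ?t $$ (i, j)"
        unfolding mat_adjoint_entry[OF Pc(1) ij] unfolding P_def P'_def
        using R[OF ij] ij carrier_matD[OF Rc[of ?t]] carrier_matD[OF cc(1)[of ?t]]
        carrier_matD[OF cc(2)[of ?t]] by auto
    qed (use carrier_matD[OF mat_adjoint_carrier[OF Pc(1)]] Pc[of ?t] in auto)
  qed
  have Qstar: "mat_adjoint (Q (of_real t)) = Q' (of_real t)" if t: "poly D (of_real t) \<noteq> 0" for t
  proof (rule mat_inverse_unique[OF Pc(2) mat_adjoint_carrier[OF Qc(1)] Qc(2) _ PQ(3)[OF t]])
    show "mat_adjoint (Q (of_real t)) * P' (of_real t) = 1\<^sub>m n"
      using mat_adjoint_mult[OF Pc(1) Qc(1), of "of_real t" "of_real t"] PQ(1)[OF t] Pstar[of t] by simp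
  qed
  have zero: "free_eval n (C (of_real t)) p = 0\<^sub>m n n" if t: "poly D (of_real t) \<noteq> 0" for t
  proof -
    let ?t = "complex_of_real t"
    have adj: "mat_adjoint (C ?t (X j)) = C ?t (XT j)" for j
      unfolding C_def
      by (simp add: mat_adjoint_phase[OF Qc(1)] Qstar[OF t] mat_adjoint_adjoint_curve[OF T S]
          mat_adjoint_mult[OF adjoint_curve_carrier[OF T S] Qc(1)])
    have "spherical_isometry n (\<lambda>j. C ?t (X j))"
      unfolding spherical_isometry_def using Cc Cinv[OF t] by (simp add: adj)
    from vanish[OF this] have "free_eval n (letter_eval (\<lambda>j. C ?t (X j))) p = 0\<^sub>m n n"
      by (simp add: nc_eval_eq_free_eval)
    moreover have "letter_eval (\<lambda>j. C ?t (X j)) = C ?t"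
    proof
      fix l show "letter_eval (\<lambda>j. C ?t (X j)) l = C ?t l" by (cases l) (simp_all add: adj)
    qed
    ultimately show ?thesis by simp
  qed
  have reg: "regular_mat D n (\<lambda>z. free_eval n (C z) p)"
    by (rule regular_mat_free_eval[OF regC])
  have "C \<i> = B" using Ci by (rule ext)
  show ?thesis
  proof (rule eq_matI)
    fix i j assume "i < dim_row (0\<^sub>m n n :: complex mat)" "j < dim_col (0\<^sub>m n n :: complex mat)"
    then have ij: "i < n" "j < n" by auto
    have "free_eval n (C \<i>) p $$ (i, j) = 0"
    proof (rule regular_off_identity[OF _ _ Di])
      show "regular_off D (\<lambda>z. free_eval n (C z) p $$ (i, j))"
        using reg ij unfolding regular_mat_def by blast
      show "free_eval n (C (of_real t)) p $$ (i, j) = 0" if "poly D (of_real t) \<noteq> 0" for t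
        using zero[OF that] ij by simp
    qed
    then show "free_eval n B p $$ (i, j) = 0\<^sub>m n n $$ (i, j)" using ij \<open>C \<i> = B\<close> by simp
  qed (simp_all add: free_eval_def)
qed

section \<open>The ideal and its words\<close>

lemma two_sided_ideal_spherical_ideal: "two_sided_ideal (spherical_ideal :: 'g::finite ncpoly set)"
  unfolding spherical_ideal_def by (rule hull_in) (auto simp: two_sided_ideal_def)

lemma spherical_relation_in_ideal:
  "1 - (\<Sum>j\<in>UNIV. ncletter (XT j) * ncletter (X j)) \<in> (spherical_ideal :: 'g::finite ncpoly set)"
  unfolding spherical_ideal_def by (rule hull_inc) simp

lemma spherical_ideal_closed:
  fixes a b r :: "'g::finite ncpoly"
  shows "0 \<in> (spherical_ideal :: 'g ncpoly set)"
    and "a \<in> spherical_ideal \<Longrightarrow> b \<in> spherical_ideal \<Longrightarrow> a + b \<in> spherical_ideal"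
    and "a \<in> spherical_ideal \<Longrightarrow> r * a \<in> spherical_ideal"
    and "a \<in> spherical_ideal \<Longrightarrow> a * r \<in> spherical_ideal"
  using two_sided_ideal_spherical_ideal[where 'g = 'g] unfolding two_sided_ideal_def by auto

lemma spherical_ideal_sum:
  "(\<And>i. i \<in> I \<Longrightarrow> f i \<in> spherical_ideal) \<Longrightarrow> sum f I \<in> (spherical_ideal :: 'g::finite ncpoly set)"
  by (induction I rule: infinite_finite_induct) (auto intro: spherical_ideal_closed)

lemma subspace_spherical_ideal: "pm.subspace (spherical_ideal :: 'g::finite ncpoly set)"
  by (rule pm.subspaceI)
     (auto intro: spherical_ideal_closed simp: pscale_def mult_map_scale_conv_mult)

lemma plinear_letter_mult: "plinear (\<lambda>q. ncletter l * q)"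
proof -
  have "ncletter l * (Poly_Mapping.single 0 c * q) = Poly_Mapping.single 0 c * (ncletter l * q)"
    for c :: complex and q
    by (simp add: mult.assoc[symmetric] mult_single)
  then show ?thesis
    unfolding Vector_Spaces.linear_iff
    by (auto simp: pscale_def[abs_def] mult_map_scale_conv_mult distrib_left
        intro: pm.vector_space_axioms[unfolded pscale_def[abs_def]])
qed

lemma letter_mult_pdelta: "ncletter l * pdelta s = pdelta (Word [l] + s)"
  by (simp add: mult_single)

lemma cons_word_eq_iff [simp]: "Word [l] + s = Word [l'] + s' \<longleftrightarrow> l = l' \<and> s = s'"
  by (cases s; cases s') (simp add: plus_free_monoid_def)

lemma cons_word_neq_0 [simp]: "Word [l] + s \<noteq> 0"
  by (simp add: plus_free_monoid_def zero_free_monoid_def)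

text \<open>
  The words on which left multiplication by the letter \<open>l\<close> stays in the span of \<open>K\<close>.
\<close>

definition sources :: "'l free_monoid set \<Rightarrow> 'l \<Rightarrow> 'l free_monoid set" where
  "sources K l = {s \<in> K. Word [l] + s \<in> K}"

lemma keys_letter_mult:
  assumes "Poly_Mapping.keys q \<subseteq> sources K l"
  shows "Poly_Mapping.keys (ncletter l * q) \<subseteq> K"
  using keys_mult[of "ncletter l" q] assms by (auto simp: sources_def)

text \<open>
  A nonempty word determines its first letter and the word that remains. Hence choosing for each
  source of some \<open>X j\<close> one such letter injects the disjoint union of the two sets of sources into the
  nonempty words of \<open>K\<close>.
\<close>

lemma card_sources:
  fixes K :: "'g::finite letter free_monoid set"
  assumes K: "finite K" "0 \<in> K"
  shows "card (\<Union>j. sources K (X j)) + card (SIGMA i:UNIV. sources K (XT i)) < card K"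
proof -
  let ?S = "\<Union>j. sources K (X j)" and ?J = "SIGMA i:UNIV. sources K (XT i)"
  have "\<forall>s\<in>?S. \<exists>j. s \<in> sources K (X j)" by blast
  then obtain ch where ch: "\<And>s. s \<in> ?S \<Longrightarrow> s \<in> sources K (X (ch s))" by metis
  let ?f = "case_sum (\<lambda>s. Word [X (ch s)] + s) (\<lambda>(i, s). Word [XT i] + s)"
  have fin: "finite (sources K l)" for l using K by (simp add: sources_def)
  then have "finite ?S" "finite ?J" by auto
  then have "card ?S + card ?J = card (?S <+> ?J)" by (simp add: card_Plus)
  also have "\<dots> \<le> card (K - {0})"
  proof (rule card_inj_on_le)
    show "inj_on ?f (?S <+> ?J)" by (auto intro!: inj_onI)
    show "?f ` (?S <+> ?J) \<subseteq> K - {0}"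
    proof (rule image_subsetI)
      fix x assume x: "x \<in> ?S <+> ?J"
      show "?f x \<in> K - {0}"
      proof (cases x)
        case (Inl s)
        then have "s \<in> sources K (X (ch s))" using x by (intro ch) auto
        then show ?thesis using Inl by (simp add: sources_def)
      qed (use x in \<open>auto simp: sources_def\<close>)
    qed
    show "finite (K - {0})" using K by simp
  qed
  also have "\<dots> < card K" using K by (intro psubset_card_mono) auto
  finally show ?thesis .
qed

definition suffix_words :: "'g ncpoly \<Rightarrow> 'g letter free_monoid set" where
  "suffix_words p = insert 0 (\<Union>w\<in>Poly_Mapping.keys p. (\<lambda>k. Word (drop k (letters w))) ` {..<length (letters w)})"

lemma finite_suffix_words [simp]: "finite (suffix_words p)"
  unfolding suffix_words_def by simp

lemma zero_in_suffix_words [simp]: "0 \<in> suffix_words p"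
  unfolding suffix_words_def by simp

lemma drop_in_suffix_words:
  assumes "w \<in> Poly_Mapping.keys p"
  shows "Word (drop k (letters w)) \<in> suffix_words p"
proof (cases "k < length (letters w)")
  case True
  then show ?thesis using assms unfolding suffix_words_def by blast
next
  case False
  then show ?thesis unfolding suffix_words_def zero_free_monoid_def by simp
qed

lemma keys_subset_suffix_words: "Poly_Mapping.keys p \<subseteq> suffix_words p"
proof
  fix w assume "w \<in> Poly_Mapping.keys p"
  from drop_in_suffix_words[OF this, of 0] show "w \<in> suffix_words p" by simp
qed

text \<open>
  The extra one is the empty word, which is a suffix of every word and is counted once.
\<close>

lemma card_suffix_words: "card (suffix_words p) \<le> ncdegree p * num_terms p + 1"
proof -
  have len: "length (letters w) \<le> ncdegree p" if "w \<in> Poly_Mapping.keys p" for w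
    unfolding ncdegree_def using that by (intro Max_ge) auto
  have "card (\<Union>w\<in>Poly_Mapping.keys p. (\<lambda>k. Word (drop k (letters w))) ` {..<length (letters w)})
      \<le> (\<Sum>w\<in>Poly_Mapping.keys p. card ((\<lambda>k. Word (drop k (letters w))) ` {..<length (letters w)}))"
    by (rule card_UN_le) simp
  also have "\<dots> \<le> (\<Sum>w\<in>Poly_Mapping.keys p. ncdegree p)"
    using len by (intro sum_mono order_trans[OF card_image_le]) auto
  finally show ?thesis
    unfolding suffix_words_def num_terms_def by (simp add: card_insert_if mult.commute)
qed

section \<open>Operators extending multiplication of words\<close>

text \<open>
  An operator realizing left multiplication by \<open>X i\<close> in the coordinates \<open>\<phi>\<close> of the quotient. The last
  clause is the key point: on the sources of all the \<open>X j\<close>, it takes values among the sources of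
  the formal adjoint \<open>XT i\<close> only where it is actual multiplication by \<open>X i\<close>.
\<close>

definition shift_operator ::
    "'g::finite letter free_monoid set \<Rightarrow> nat \<Rightarrow> ('g ncpoly \<Rightarrow> (nat \<Rightarrow>\<^sub>0 complex)) \<Rightarrow> 'g \<Rightarrow>
      ((nat \<Rightarrow>\<^sub>0 complex) \<Rightarrow> (nat \<Rightarrow>\<^sub>0 complex)) \<Rightarrow> bool" where
  "shift_operator K n \<phi> i T \<longleftrightarrow> plinear T \<and>
    (\<forall>q. Poly_Mapping.keys q \<subseteq> sources K (X i) \<longrightarrow> T (\<phi> q) = \<phi> (ncletter (X i) * q)) \<and>
    (\<forall>j. \<forall>s\<in>sources K (X j). Poly_Mapping.keys (T (\<phi> (pdelta s))) \<subseteq> {..<n}) \<and>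
    (\<forall>v\<in>pm.span ((\<lambda>s. \<phi> (pdelta s)) ` (\<Union>j. sources K (X j))).
      T v \<in> pm.span ((\<lambda>s. \<phi> (pdelta s)) ` sources K (XT i)) \<longrightarrow>
      v \<in> pm.span ((\<lambda>s. \<phi> (pdelta s)) ` sources K (X i)))"

text \<open>
  Multiplication by \<open>X i\<close> is well defined in coordinates because the ideal is a left ideal; it is then
  extended injectively modulo the sources of \<open>XT i\<close>, for which the count of sources leaves room in dimension
  \<open>n\<close>.
\<close>

lemma shift_extension:
  fixes K :: "'g::finite letter free_monoid set" and \<phi> :: "'g ncpoly \<Rightarrow> (nat \<Rightarrow>\<^sub>0 complex)"
  assumes K: "finite K" "0 \<in> K" "card K \<le> n"
    and \<phi>: "plinear \<phi>" "\<And>x. Poly_Mapping.keys (\<phi> x) \<subseteq> {..<n}"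
      "\<And>x. Poly_Mapping.keys x \<subseteq> K \<Longrightarrow> \<phi> x = 0 \<longleftrightarrow> x \<in> spherical_ideal"
  shows "\<exists>T. shift_operator K n \<phi> i T"
proof -
  let ?V = "{q :: 'g ncpoly. Poly_Mapping.keys q \<subseteq> sources K (X i)}"
  let ?\<psi> = "\<lambda>s. \<phi> (pdelta s)"
  let ?W = "{x :: nat \<Rightarrow>\<^sub>0 complex. Poly_Mapping.keys x \<subseteq> {..<n}}"
  have Weq: "?W = pm.span (pdelta ` {..<n})" by (auto simp: in_span_pdelta_iff)
  have Veq: "?V = pm.span (pdelta ` sources K (X i))" by (auto simp: in_span_pdelta_iff)
  have subK: "sources K l \<subseteq> K" for l by (auto simp: sources_def)
  have g: "plinear (\<lambda>q. \<phi> (ncletter (X i) * q))"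
    using Vector_Spaces.linear_compose[OF plinear_letter_mult[of "X i"] \<phi>(1)] by (simp add: o_def)
  have Vsub: "pm.subspace ?V" unfolding Veq by (rule pm.subspace_span)
  have ker: "\<phi> (ncletter (X i) * q) = 0" if "q \<in> ?V" "\<phi> q = 0" for q
  proof -
    have "Poly_Mapping.keys q \<subseteq> K" using that(1) subK[of "X i"] by blast
    then have "q \<in> spherical_ideal" using \<phi>(3) that(2) by blast
    then have "ncletter (X i) * q \<in> spherical_ideal" by (rule spherical_ideal_closed)
    moreover have "Poly_Mapping.keys (ncletter (X i) * q) \<subseteq> K"
      using that(1) by (intro keys_letter_mult) simp
    ultimately show ?thesis using \<phi>(3) by blast
  qed
  obtain T0 where T0: "plinear T0" "\<forall>q\<in>?V. T0 (\<phi> q) = \<phi> (ncletter (X i) * q)"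
    by (rule pmp.linear_factor_through[OF \<phi>(1) Vsub g ker])
  let ?Sx = "\<Union>j. sources K (X j)"
  have finS: "finite (sources K l)" for l using K(1) subK finite_subset by blast
  have cA: "card (sources K (XT i)) \<le> card (SIGMA i:UNIV. sources K (XT i))"
    by (rule card_inj_on_le[of "\<lambda>s. (i, s)"]) (auto intro!: inj_onI finS)
  have cardM: "card (pdelta ` {..<n} :: (nat \<Rightarrow>\<^sub>0 complex) set) = n"
    by (subst card_image) (auto intro!: inj_onI)
  have card: "card (?\<psi> ` ?Sx) + card (?\<psi> ` sources K (XT i)) \<le> card (pdelta ` {..<n} :: (nat \<Rightarrow>\<^sub>0 complex) set)"
    unfolding cardM
    using card_image_le[of ?Sx ?\<psi>] card_image_le[of "sources K (XT i)" ?\<psi>] cA card_sources[OF K(1,2)] K(3) finS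
    by simp
  have T0W: "T0 ` ?\<psi> ` sources K (X i) \<subseteq> ?W"
  proof safe
    fix s k assume s: "s \<in> sources K (X i)" and k: "k \<in> Poly_Mapping.keys (T0 (\<phi> (pdelta s)))"
    have "T0 (\<phi> (pdelta s)) = \<phi> (ncletter (X i) * pdelta s)" using T0(2) s by simp
    then show "k < n" using k \<phi>(2)[of "ncletter (X i) * pdelta s"] by auto
  qed
  have Wsub: "pm.subspace ?W" unfolding Weq by (rule pm.subspace_span)
  have PQ: "?\<psi> ` sources K (X i) \<subseteq> ?\<psi> ` ?Sx" by blast
  have MW: "pdelta ` {..<n} \<subseteq> ?W" by auto
  have fin: "finite (?\<psi> ` ?Sx)" "finite (?\<psi> ` sources K (XT i))" using finS by auto
  obtain T where T: "plinear T" "\<forall>x\<in>pm.span (?\<psi> ` sources K (X i)). T x = T0 x"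
      "T ` ?\<psi> ` ?Sx \<subseteq> ?W"
      "\<forall>v\<in>pm.span (?\<psi> ` ?Sx). T v \<in> pm.span (?\<psi> ` sources K (XT i)) \<longrightarrow>
        v \<in> pm.span (?\<psi> ` sources K (X i))"
    by (rule pmp.linear_extend_injectively_modulo[OF T0(1) fin(1) PQ Wsub T0W fin(2)
          independent_pdelta MW card])
  show ?thesis
    unfolding shift_operator_def
  proof (intro exI[of _ T] conjI allI impI ballI)
    fix q :: "'g ncpoly" assume q: "Poly_Mapping.keys q \<subseteq> sources K (X i)"
    then have "\<phi> q \<in> pm.span (?\<psi> ` sources K (X i))"
      unfolding span_image_pdelta[OF \<phi>(1)] by blast
    then show "T (\<phi> q) = \<phi> (ncletter (X i) * q)" using T(2) T0(2) q by simp
  next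
    fix j s assume "s \<in> sources K (X j)"
    then have "T (?\<psi> s) \<in> ?W" using T(3) by blast
    then show "Poly_Mapping.keys (T (?\<psi> s)) \<subseteq> {..<n}" by simp
  next
    fix v assume "v \<in> pm.span (?\<psi> ` ?Sx)" "T v \<in> pm.span (?\<psi> ` sources K (XT i))"
    then show "v \<in> pm.span (?\<psi> ` sources K (X i))" using T(4) by blast
  qed (rule T(1))
qed

text \<open>
  Consistency of the prescriptions for the operators \<open>Y\<^sub>i\<close>. Here \<open>v\<close> is a vector that is sent into the
  sources of the formal adjoints, the \<open>i\<close>-th component being \<open>- h\<^sub>i\<close>, and \<open>q\<^sub>i\<close> represents \<open>v\<close> by
  sources of \<open>X\<^sub>i\<close>. All the \<open>q\<^sub>i\<close> agree modulo the ideal, so the relation gives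
  \<open>- \<Sum>\<^sub>i Y\<^sub>i h\<^sub>i \<equiv> \<Sum>\<^sub>i Y\<^sub>i X\<^sub>i q\<^sub>i \<equiv> q\<close> for any one of them.
\<close>

lemma shift_consistent:
  fixes K :: "'g::finite letter free_monoid set" and \<phi> :: "'g ncpoly \<Rightarrow> (nat \<Rightarrow>\<^sub>0 complex)"
    and q h :: "'g \<Rightarrow> 'g ncpoly"
  assumes \<phi>: "plinear \<phi>"
      "\<And>x. Poly_Mapping.keys x \<subseteq> K \<Longrightarrow> \<phi> x = 0 \<longleftrightarrow> x \<in> spherical_ideal"
    and q: "\<And>i. Poly_Mapping.keys (q i) \<subseteq> sources K (X i)" "\<And>i. \<phi> (q i) = v"
    and h: "\<And>i. Poly_Mapping.keys (h i) \<subseteq> sources K (XT i)"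
      "\<And>i. \<phi> (ncletter (X i) * q i) + \<phi> (h i) = 0"
  shows "v + (\<Sum>i\<in>UNIV. \<phi> (ncletter (XT i) * h i)) = 0"
proof -
  interpret p: Vector_Spaces.linear pscale pscale \<phi> by (rule \<phi>(1))
  define i0 :: 'g where "i0 = undefined"
  have subK: "sources K l \<subseteq> K" for l by (auto simp: sources_def)
  have keysq: "Poly_Mapping.keys (q i) \<subseteq> K" for i using q(1)[of i] subK by blast
  have keysh: "Poly_Mapping.keys (h i) \<subseteq> K" for i using h(1)[of i] subK by blast
  have keysX: "Poly_Mapping.keys (ncletter (X i) * q i) \<subseteq> K" for i
    by (rule keys_letter_mult[OF q(1)])
  have keysXT: "Poly_Mapping.keys (ncletter (XT i) * h i) \<subseteq> K" for i
    by (rule keys_letter_mult[OF h(1)])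
  have K_sub: "pm.subspace {x. Poly_Mapping.keys x \<subseteq> K}"
  proof -
    have "{x. Poly_Mapping.keys x \<subseteq> K} = pm.span (pdelta ` K)" by (auto simp: in_span_pdelta_iff)
    then show ?thesis by simp
  qed
  have I1: "q i0 - q i \<in> spherical_ideal" for i
  proof -
    have "Poly_Mapping.keys (q i0 - q i) \<subseteq> K"
      using pm.subspace_diff[OF K_sub, of "q i0" "q i"] keysq by simp
    moreover have "\<phi> (q i0 - q i) = 0" by (simp add: p.diff q(2))
    ultimately show ?thesis using \<phi>(2) by blast
  qed
  have I2: "ncletter (X i) * q i + h i \<in> spherical_ideal" for i
  proof -
    have "Poly_Mapping.keys (ncletter (X i) * q i + h i) \<subseteq> K"
      using pm.subspace_add[OF K_sub, of "ncletter (X i) * q i" "h i"] keysX keysh by simp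
    moreover have "\<phi> (ncletter (X i) * q i + h i) = 0" by (simp add: p.add h(2))
    ultimately show ?thesis using \<phi>(2) by blast
  qed
  have "(1 - (\<Sum>i\<in>UNIV. ncletter (XT i) * ncletter (X i))) * q i0
      + (\<Sum>i\<in>UNIV. ncletter (XT i) * ncletter (X i) * (q i0 - q i)
          + ncletter (XT i) * (ncletter (X i) * q i + h i)) \<in> spherical_ideal"
    by (intro spherical_ideal_closed(2) spherical_ideal_closed(4)[OF spherical_relation_in_ideal]
        spherical_ideal_sum spherical_ideal_closed(3) I1 I2)
  also have "(1 - (\<Sum>i\<in>UNIV. ncletter (XT i) * ncletter (X i))) * q i0
      + (\<Sum>i\<in>UNIV. ncletter (XT i) * ncletter (X i) * (q i0 - q i)
          + ncletter (XT i) * (ncletter (X i) * q i + h i)) = q i0 + (\<Sum>i\<in>UNIV. ncletter (XT i) * h i)"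
    by (simp add: left_diff_distrib right_diff_distrib distrib_left mult.assoc sum.distrib
        sum_subtractf sum_distrib_right)
  finally have "q i0 + (\<Sum>i\<in>UNIV. ncletter (XT i) * h i) \<in> spherical_ideal" .
  moreover have "Poly_Mapping.keys (q i0 + (\<Sum>i\<in>UNIV. ncletter (XT i) * h i)) \<subseteq> K"
    using pm.subspace_add[OF K_sub, of "q i0" "\<Sum>i\<in>UNIV. ncletter (XT i) * h i"]
      pm.subspace_sum[OF K_sub, of UNIV "\<lambda>i. ncletter (XT i) * h i"] keysq keysXT by simp
  ultimately have "\<phi> (q i0 + (\<Sum>i\<in>UNIV. ncletter (XT i) * h i)) = 0" using \<phi>(2) by blast
  then show ?thesis by (simp add: p.add p.sum q(2))
qed

definition coord_vec :: "nat \<Rightarrow> (nat \<Rightarrow>\<^sub>0 complex) \<Rightarrow> complex vec" where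
  "coord_vec n x = vec n (Poly_Mapping.lookup x)"

lemma mat_mult_coord_vec:
  assumes f: "plinear f" and x: "Poly_Mapping.keys x \<subseteq> {..<n}"
    and e: "\<And>r. r < n \<Longrightarrow> Poly_Mapping.lookup (f x) (c r) = Poly_Mapping.lookup y r"
  shows "mat n n (\<lambda>(r, k). Poly_Mapping.lookup (f (pdelta k)) (c r)) *\<^sub>v coord_vec n x = coord_vec n y"
proof (rule eq_vecI)
  fix r assume "r < dim_vec (coord_vec n y)"
  then have r: "r < n" by (simp add: coord_vec_def)
  have "(mat n n (\<lambda>(r, k). Poly_Mapping.lookup (f (pdelta k)) (c r)) *\<^sub>v coord_vec n x) $ r =
      (\<Sum>k<n. Poly_Mapping.lookup (f (pdelta k)) (c r) * Poly_Mapping.lookup x k)"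
    using r by (simp add: coord_vec_def scalar_prod_def atLeast0LessThan)
  also have "\<dots> = Poly_Mapping.lookup (f x) (c r)"
    by (subst lookup_plinear[OF f _ x]) (simp_all add: mult.commute)
  finally show "(mat n n (\<lambda>(r, k). Poly_Mapping.lookup (f (pdelta k)) (c r)) *\<^sub>v coord_vec n x) $ r = coord_vec n y $ r"
    using r e by (simp add: coord_vec_def)
qed (simp add: coord_vec_def)

text \<open>
  The column of operators is built by two injective extensions, one inside each component (\<open>T\<close>), on the
  sources only, and one for the whole column (\<open>U\<close>), on the whole space. The row \<open>Y\<close> is then prescribed
  on two families of vectors: the sources of the formal adjoints, where it is multiplication, and the
  images of the unit vectors under the column, where it is the inverse. A linear dependency between these
  vectors is a vector \<open>v\<close> which the column sends into the sources of the formal adjoints; by the two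
  injectivity properties it lies among the sources of every \<open>X i\<close>, so that the prescriptions are consistent.
\<close>

lemma left_inverse_pair_extending_words:
  fixes K :: "'g::finite letter free_monoid set" and \<phi> :: "'g ncpoly \<Rightarrow> (nat \<Rightarrow>\<^sub>0 complex)"
  assumes g: "CARD('g) > 1" and K: "finite K" "0 \<in> K" "card K \<le> n"
    and \<phi>: "plinear \<phi>" "\<And>x. Poly_Mapping.keys (\<phi> x) \<subseteq> {..<n}"
      "\<And>x. Poly_Mapping.keys x \<subseteq> K \<Longrightarrow> \<phi> x = 0 \<longleftrightarrow> x \<in> spherical_ideal"
  shows "\<exists>B :: 'g letter \<Rightarrow> complex mat. (\<forall>l. B l \<in> carrier_mat n n) \<and>
    mat_sum n (\<lambda>j. B (XT j) * B (X j)) UNIV = 1\<^sub>m n \<and>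
    (\<forall>l. \<forall>s\<in>sources K l.
      B l *\<^sub>v coord_vec n (\<phi> (pdelta s)) = coord_vec n (\<phi> (pdelta (Word [l] + s))))"
proof -
  let ?\<psi> = "\<lambda>s. \<phi> (pdelta s)"
  let ?Sx = "\<Union>j. sources K (X j)"
  let ?J = "SIGMA i:(UNIV :: 'g set). sources K (XT i)"
  interpret p: Vector_Spaces.linear pscale pscale \<phi> by (rule \<phi>(1))
  have finS: "finite (sources K l)" for l using K(1) by (simp add: sources_def)
  obtain T where shift: "\<And>i. shift_operator K n \<phi> i (T i)"
    using shift_extension[OF K \<phi>] by metis
  have T: "plinear (T i)"
    "Poly_Mapping.keys q \<subseteq> sources K (X i) \<Longrightarrow> T i (\<phi> q) = \<phi> (ncletter (X i) * q)"
    "s \<in> sources K (X j) \<Longrightarrow> Poly_Mapping.keys (T i (?\<psi> s)) \<subseteq> {..<n}"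
    "v \<in> pm.span (?\<psi> ` ?Sx) \<Longrightarrow> T i v \<in> pm.span (?\<psi> ` sources K (XT i)) \<Longrightarrow>
      v \<in> pm.span (?\<psi> ` sources K (X i))" for i j q s v
    using shift[of i] unfolding shift_operator_def by simp_all
  obtain emb :: "'g \<Rightarrow> (nat \<Rightarrow>\<^sub>0 complex) \<Rightarrow> ('g \<times> nat \<Rightarrow>\<^sub>0 complex)"
    where emb: "\<forall>i. plinear (emb i)" "\<forall>i k. emb i (pdelta k) = pdelta (i, k)"
      "\<forall>x i k. Poly_Mapping.lookup (\<Sum>j\<in>UNIV. emb j (x j)) (i, k) = Poly_Mapping.lookup (x i) k"
    by (rule component_embeddings)
  have embl: "plinear (emb i)" for i using emb(1) by blast
  define tup where "tup v = (\<Sum>i\<in>UNIV. emb i (T i v))" for v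
  have tup: "plinear tup"
    unfolding tup_def[abs_def]
    by (intro pmp.linear_compose_sum ballI Vector_Spaces.linear_compose[OF T(1) embl, unfolded o_def])
  have lookup_tup: "Poly_Mapping.lookup (tup v) (i, k) = Poly_Mapping.lookup (T i v) k" for v i k
    unfolding tup_def by (rule emb(3)[rule_format, of "\<lambda>i. T i v"])
  define W :: "('g \<times> nat \<Rightarrow>\<^sub>0 complex) set" where "W = {x. Poly_Mapping.keys x \<subseteq> UNIV \<times> {..<n}}"
  have Weq: "W = pm.span (pdelta ` (UNIV \<times> {..<n}))" unfolding W_def by (auto simp: in_span_pdelta_iff)
  have Wsub: "pm.subspace W" unfolding Weq by (rule pm.subspace_span)
  have MW: "pdelta ` (UNIV \<times> {..<n}) \<subseteq> W" unfolding W_def by auto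
  have tupW: "tup ` ?\<psi> ` ?Sx \<subseteq> W"
  proof (rule image_subsetI)
    fix x assume "x \<in> ?\<psi> ` ?Sx"
    then obtain s j where s: "s \<in> sources K (X j)" "x = ?\<psi> s" by blast
    show "tup x \<in> W" unfolding W_def
    proof safe
      fix i k assume "(i, k) \<in> Poly_Mapping.keys (tup x)"
      then have "k \<in> Poly_Mapping.keys (T i (?\<psi> s))" by (simp add: in_keys_iff lookup_tup s(2))
      then show "k < n" using T(3)[OF s(1)] by blast
    qed simp
  qed
  define A where "A = (\<lambda>(i, s). emb i (?\<psi> s)) ` ?J"
  define Q where "Q = ?\<psi> ` ?Sx \<union> pdelta ` {..<n}"
  have finQ: "finite Q" and finA: "finite A" unfolding Q_def A_def using finS by auto
  have PQ: "?\<psi> ` ?Sx \<subseteq> Q" unfolding Q_def by blast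
  have card: "card Q + card A \<le> card (pdelta ` (UNIV \<times> {..<n}) :: ('g \<times> nat \<Rightarrow>\<^sub>0 complex) set)"
  proof -
    have "card Q \<le> card ?Sx + n"
      unfolding Q_def using card_Un_le[of "?\<psi> ` ?Sx" "pdelta ` {..<n}"]
        card_image_le[of ?Sx ?\<psi>] card_image_le[of "{..<n}" "pdelta :: nat \<Rightarrow> (nat \<Rightarrow>\<^sub>0 complex)"] finS by simp
    moreover have "card A \<le> card ?J" unfolding A_def using finS by (intro card_image_le) auto
    \<comment> \<open>\<open>Q\<close> may have up to \<open>2 n - 1\<close> elements although it spans a space of dimension \<open>n\<close>; two components leave room for this\<close>
    ultimately have "card Q + card A \<le> n + n" using card_sources[OF K(1,2)] K(3) by linarith
    also have "\<dots> \<le> CARD('g) * n" using g mult_le_mono1[of 2 "CARD('g)" n] by linarith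
    also have "\<dots> = card (pdelta ` (UNIV \<times> {..<n}) :: ('g \<times> nat \<Rightarrow>\<^sub>0 complex) set)"
      by (subst card_image) (auto intro!: inj_onI simp: card_cartesian_product)
    finally show ?thesis .
  qed
  obtain U where U: "plinear U" "\<forall>x\<in>pm.span (?\<psi> ` ?Sx). U x = tup x" "U ` Q \<subseteq> W"
    "\<forall>v\<in>pm.span Q. U v \<in> pm.span A \<longrightarrow> v \<in> pm.span (?\<psi> ` ?Sx)"
    by (rule pmp.linear_extend_injectively_modulo[OF tup finQ PQ Wsub tupW finA
          independent_pdelta MW card])
  \<comment> \<open>the unit vectors of the domain of \<open>a\<close> and \<open>b\<close> index the prescriptions: \<open>Y\<close> has to satisfy \<open>Y \<circ> a = b\<close>\<close>
  obtain a :: "(('g \<times> 'g letter free_monoid) + nat \<Rightarrow>\<^sub>0 complex) \<Rightarrow> ('g \<times> nat \<Rightarrow>\<^sub>0 complex)"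
    where a: "plinear a" "\<forall>k. a (pdelta k) =
      (case k of Inl (i, s) \<Rightarrow> emb i (?\<psi> s) | Inr k \<Rightarrow> U (pdelta k))"
    by (rule plinear_exists)
  obtain b :: "(('g \<times> 'g letter free_monoid) + nat \<Rightarrow>\<^sub>0 complex) \<Rightarrow> (nat \<Rightarrow>\<^sub>0 complex)"
    where b: "plinear b" "\<forall>k. b (pdelta k) =
      (case k of Inl (i, s) \<Rightarrow> ?\<psi> (Word [XT i] + s) | Inr k \<Rightarrow> pdelta k)"
    by (rule plinear_exists)
  define V where "V = {c :: ('g \<times> 'g letter free_monoid) + nat \<Rightarrow>\<^sub>0 complex.
    Poly_Mapping.keys c \<subseteq> ?J <+> {..<n}}"
  have Vsub: "pm.subspace V"
  proof -
    have "V = pm.span (pdelta ` (?J <+> {..<n}))" unfolding V_def by (auto simp: in_span_pdelta_iff)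
    then show ?thesis by simp
  qed
  have ker: "b c = 0" if c: "c \<in> V" "a c = 0" for c
  proof -
    define h where "h i = (\<Sum>s\<in>sources K (XT i). pscale (Poly_Mapping.lookup c (Inl (i, s))) (pdelta s))" for i
    define v :: "nat \<Rightarrow>\<^sub>0 complex" where "v = (\<Sum>k<n. pscale (Poly_Mapping.lookup c (Inr k)) (pdelta k))"
    have fin: "finite (?J <+> {..<n})" using finS by auto
    have split: "f c = (\<Sum>i\<in>UNIV. \<Sum>s\<in>sources K (XT i). pscale (Poly_Mapping.lookup c (Inl (i, s))) (f (pdelta (Inl (i, s)))))
        + (\<Sum>k<n. pscale (Poly_Mapping.lookup c (Inr k)) (f (pdelta (Inr k))))"
      if "plinear f" for f :: "(('g \<times> 'g letter free_monoid) + nat \<Rightarrow>\<^sub>0 complex) \<Rightarrow> ('x \<Rightarrow>\<^sub>0 complex)"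
      using c(1) finS unfolding V_def
      by (subst plinear_sum_pdelta[OF that fin])
         (auto simp: sum.Plus sum.Sigma case_prod_beta)
    have \<phi>h: "\<phi> (h i) = (\<Sum>s\<in>sources K (XT i). pscale (Poly_Mapping.lookup c (Inl (i, s))) (?\<psi> s))" for i
      unfolding h_def by (simp add: p.sum p.scale)
    have embh: "emb i (\<phi> (h i)) = (\<Sum>s\<in>sources K (XT i). pscale (Poly_Mapping.lookup c (Inl (i, s))) (emb i (?\<psi> s)))" for i
    proof -
      interpret e: Vector_Spaces.linear pscale pscale "emb i" by (rule embl)
      show ?thesis unfolding \<phi>h by (simp add: e.sum e.scale)
    qed
    have Uv: "U v = (\<Sum>k<n. pscale (Poly_Mapping.lookup c (Inr k)) (U (pdelta k)))"
    proof -
      interpret u: Vector_Spaces.linear pscale pscale U by (rule U(1))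
      show ?thesis unfolding v_def by (simp add: u.sum u.scale)
    qed
    have ac: "(\<Sum>i\<in>UNIV. emb i (\<phi> (h i))) + U v = 0"
      using split[OF a(1)] c(2) a(2) by (simp add: embh Uv)
    have "(\<Sum>i\<in>UNIV. emb i (\<phi> (h i))) \<in> pm.span A"
      unfolding embh A_def by (intro pm.span_sum pm.span_scale pm.span_base) force
    then have "- (\<Sum>i\<in>UNIV. emb i (\<phi> (h i))) \<in> pm.span A" by (rule pm.span_neg)
    moreover have "U v = - (\<Sum>i\<in>UNIV. emb i (\<phi> (h i)))" using ac by (simp add: eq_neg_iff_add_eq_0 add.commute)
    ultimately have "U v \<in> pm.span A" by simp
    moreover have "v \<in> pm.span Q"
      unfolding v_def Q_def by (intro pm.span_sum pm.span_scale pm.span_base) auto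
    ultimately have vP: "v \<in> pm.span (?\<psi> ` ?Sx)" using U(4) by blast
    then have "U v = tup v" using U(2) by blast
    then have Tv: "T i v = - \<phi> (h i)" for i
    proof (intro poly_mapping_eqI)
      fix k
      have "Poly_Mapping.lookup ((\<Sum>i\<in>UNIV. emb i (\<phi> (h i))) + tup v) (i, k) = 0"
        using ac \<open>U v = tup v\<close> by simp
      then have "Poly_Mapping.lookup (\<phi> (h i)) k + Poly_Mapping.lookup (T i v) k = 0"
        using emb(3) by (simp add: lookup_add lookup_tup)
      then show "Poly_Mapping.lookup (T i v) k = Poly_Mapping.lookup (- \<phi> (h i)) k"
        by (simp add: eq_neg_iff_add_eq_0 add.commute)
    qed
    have "\<exists>q. Poly_Mapping.keys q \<subseteq> sources K (X i) \<and> \<phi> q = v" for i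
    proof -
      have "\<phi> (h i) \<in> pm.span (?\<psi> ` sources K (XT i))"
        unfolding \<phi>h by (intro pm.span_sum pm.span_scale pm.span_base) auto
      then have "T i v \<in> pm.span (?\<psi> ` sources K (XT i))" unfolding Tv by (rule pm.span_neg)
      from T(4)[OF vP this] show ?thesis unfolding span_image_pdelta[OF \<phi>(1)] by blast
    qed
    then obtain q where q: "\<And>i. Poly_Mapping.keys (q i) \<subseteq> sources K (X i)" "\<And>i. \<phi> (q i) = v" by metis
    have hk: "Poly_Mapping.keys (h i) \<subseteq> sources K (XT i)" for i
      unfolding in_span_pdelta_iff[symmetric] h_def by (intro pm.span_sum pm.span_scale pm.span_base) auto
    have "v + (\<Sum>i\<in>UNIV. \<phi> (ncletter (XT i) * h i)) = 0"
    proof (rule shift_consistent[OF \<phi>(1,3) q hk])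
      fix i
      have "\<phi> (ncletter (X i) * q i) = - \<phi> (h i)"
        using T(2)[OF q(1)[of i]] Tv[of i] unfolding q(2) by (rule trans[OF sym])
      then show "\<phi> (ncletter (X i) * q i) + \<phi> (h i) = 0" by simp
    qed
    moreover have "\<phi> (ncletter (XT i) * h i) =
        (\<Sum>s\<in>sources K (XT i). pscale (Poly_Mapping.lookup c (Inl (i, s))) (?\<psi> (Word [XT i] + s)))" for i
    proof -
      interpret m: Vector_Spaces.linear pscale pscale "\<lambda>q. ncletter (XT i) * q" by (rule plinear_letter_mult)
      show ?thesis unfolding h_def by (simp add: m.sum m.scale p.sum p.scale letter_mult_pdelta)
    qed
    ultimately show "b c = 0"
      using split[OF b(1)] b(2) by (simp add: v_def add.commute)
  qed
  obtain Y where Y: "plinear Y" "\<forall>c\<in>V. Y (a c) = b c"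
    by (rule pmp.linear_factor_through[OF a(1) Vsub b(1) ker])
  have Y1: "Y (emb i (?\<psi> s)) = ?\<psi> (Word [XT i] + s)" if "s \<in> sources K (XT i)" for i s
  proof -
    have "pdelta (Inl (i, s)) \<in> V" using that unfolding V_def by auto
    from Y(2)[rule_format, OF this] show ?thesis using a(2) b(2) by simp
  qed
  have Y2: "Y (U (pdelta k)) = pdelta k" if "k < n" for k
  proof -
    have "pdelta (Inr k) \<in> V" using that unfolding V_def by auto
    from Y(2)[rule_format, OF this] show ?thesis using a(2) b(2) by simp
  qed
  define B where "B l = (case l of
      X i \<Rightarrow> mat n n (\<lambda>(r, k). Poly_Mapping.lookup (U (pdelta k)) (i, r))
    | XT i \<Rightarrow> mat n n (\<lambda>(r, k). Poly_Mapping.lookup (Y (emb i (pdelta k))) r))" for l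
  have Bc: "B l \<in> carrier_mat n n" for l unfolding B_def by (cases l) auto
  have "mat_sum n (\<lambda>j. B (XT j) * B (X j)) UNIV = 1\<^sub>m n"
  proof (rule eq_matI)
    fix r c assume "r < dim_row (1\<^sub>m n :: complex mat)" "c < dim_col (1\<^sub>m n :: complex mat)"
    then have rc: "r < n" "c < n" by auto
    have "pdelta c \<in> Q" unfolding Q_def using rc by simp
    then have "U (pdelta c) \<in> W" by (rule subsetD[OF U(3) imageI])
    then have keys: "Poly_Mapping.keys (U (pdelta c)) \<subseteq> UNIV \<times> {..<n}" unfolding W_def by simp
    have "mat_sum n (\<lambda>j. B (XT j) * B (X j)) UNIV $$ (r, c) =
        (\<Sum>j\<in>UNIV. \<Sum>k<n. B (XT j) $$ (r, k) * B (X j) $$ (k, c))"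
      using rc by (simp add: mult_mat_entry[OF Bc Bc rc])
    also have "\<dots> = (\<Sum>j\<in>UNIV. \<Sum>k<n. Poly_Mapping.lookup (U (pdelta c)) (j, k) *
        Poly_Mapping.lookup (Y (pdelta (j, k))) r)"
      using rc emb(2) by (intro sum.cong refl) (simp add: B_def)
    also have "\<dots> = (\<Sum>jk\<in>UNIV \<times> {..<n}. Poly_Mapping.lookup (U (pdelta c)) jk *
        Poly_Mapping.lookup (Y (pdelta jk)) r)"
      by (simp add: sum.cartesian_product case_prod_beta)
    also have "\<dots> = Poly_Mapping.lookup (Y (U (pdelta c))) r"
      by (rule lookup_plinear[OF Y(1) _ keys, symmetric]) simp
    also have "\<dots> = 1\<^sub>m n $$ (r, c)"
      using rc by (simp add: Y2 lookup_single when_def)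
    finally show "mat_sum n (\<lambda>j. B (XT j) * B (X j)) UNIV $$ (r, c) = 1\<^sub>m n $$ (r, c)" .
  qed simp_all
  moreover have "B l *\<^sub>v coord_vec n (?\<psi> s) = coord_vec n (?\<psi> (Word [l] + s))"
    if s: "s \<in> sources K l" for l s
  proof (cases l)
    case (X i)
    have "?\<psi> s \<in> pm.span (?\<psi> ` ?Sx)" using s X by (intro pm.span_base) blast
    then have "U (?\<psi> s) = tup (?\<psi> s)" using U(2) by blast
    moreover have "T i (?\<psi> s) = ?\<psi> (Word [X i] + s)"
      using T(2)[of "pdelta s" i] s X by (simp add: letter_mult_pdelta)
    ultimately show ?thesis
      unfolding X B_def letter.case by (intro mat_mult_coord_vec[OF U(1) \<phi>(2)]) (simp add: lookup_tup)
  next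
    case (XT i)
    have lin: "plinear (\<lambda>x. Y (emb i x))"
      using Vector_Spaces.linear_compose[OF embl[of i] Y(1)] by (simp add: o_def)
    show ?thesis
      unfolding XT B_def letter.case using s XT by (intro mat_mult_coord_vec[OF lin \<phi>(2)]) (simp add: Y1)
  qed
  ultimately show ?thesis using Bc by blast
qed

section \<open>Evaluation on suffixes and the size bound\<close>

lemma mult_mat_vec_entry:
  assumes "A \<in> carrier_mat n n" "x \<in> carrier_vec n" "r < n"
  shows "(A *\<^sub>v x) $ r = (\<Sum>k<n. A $$ (r, k) * x $ k)"
  using assms by (auto simp: scalar_prod_def atLeast0LessThan intro!: sum.cong)

text \<open>
  Splitting \<open>ws\<close> as \<open>ks @ ls\<close> records that only suffixes of \<open>ws\<close> are ever reached, which are the only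
  places where the action of a letter is known.
\<close>

lemma foldr_mult_mat_vec:
  fixes B :: "'l \<Rightarrow> complex mat"
  assumes B: "\<And>l. B l \<in> carrier_mat n n" and x: "\<And>ls. x ls \<in> carrier_vec n"
    and step: "\<And>l ls ks. ks @ l # ls = ws \<Longrightarrow> B l *\<^sub>v x ls = x (l # ls)"
    and "ks @ ls = ws"
  shows "foldr (\<lambda>l M. B l * M) ls (1\<^sub>m n) \<in> carrier_mat n n \<and>
    foldr (\<lambda>l M. B l * M) ls (1\<^sub>m n) *\<^sub>v x [] = x ls"
  using \<open>ks @ ls = ws\<close>
proof (induction ls arbitrary: ks)
  case Nil
  show ?case using x[of "[]"] by simp
next
  case (Cons l ls)
  let ?M = "foldr (\<lambda>l M. B l * M) ls (1\<^sub>m n)"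
  have IH: "?M \<in> carrier_mat n n" "?M *\<^sub>v x [] = x ls"
    using Cons.IH[of "ks @ [l]"] Cons.prems by simp_all
  have "(B l * ?M) *\<^sub>v x [] = B l *\<^sub>v (?M *\<^sub>v x [])"
    by (rule assoc_mult_mat_vec[OF B IH(1) x])
  then show ?case
    using IH step[OF Cons.prems] mult_carrier_mat[OF B IH(1)] by simp
qed

text \<open>
  Read from the right, a word of \<open>p\<close> moves the class of the empty word through the classes of its suffixes
  to its own class.
\<close>

lemma free_eval_mult_vec:
  assumes B: "\<And>l. B l \<in> carrier_mat n n" and \<phi>: "plinear \<phi>"
    and step: "\<And>l s. s \<in> sources (suffix_words p) l \<Longrightarrow>
      B l *\<^sub>v coord_vec n (\<phi> (pdelta s)) = coord_vec n (\<phi> (pdelta (Word [l] + s)))"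
  shows "free_eval n B p *\<^sub>v coord_vec n (\<phi> (pdelta 0)) = coord_vec n (\<phi> p)"
proof (rule eq_vecI)
  let ?x = "coord_vec n (\<phi> (pdelta 0))"
  let ?W = "\<lambda>w. foldr (\<lambda>l M. B l * M) (letters w) (1\<^sub>m n)"
  have xc: "coord_vec n y \<in> carrier_vec n" for y by (simp add: coord_vec_def)
  have W: "?W w \<in> carrier_mat n n \<and> ?W w *\<^sub>v ?x = coord_vec n (\<phi> (pdelta w))"
    if w: "w \<in> Poly_Mapping.keys p" for w
  proof -
    have "?W w \<in> carrier_mat n n \<and> ?W w *\<^sub>v coord_vec n (\<phi> (pdelta (Word []))) =
        coord_vec n (\<phi> (pdelta (Word (letters w))))"
    proof (rule foldr_mult_mat_vec[where x = "\<lambda>ls. coord_vec n (\<phi> (pdelta (Word ls)))" and ks = "[]"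
          and ws = "letters w"])
      fix l ls ks assume eq: "ks @ l # ls = letters w"
      have "drop (length ks) (letters w) = l # ls" "drop (Suc (length ks)) (letters w) = ls"
        unfolding eq[symmetric] by simp_all
      then have "Word (l # ls) \<in> suffix_words p" "Word ls \<in> suffix_words p"
        using drop_in_suffix_words[OF w] by metis+
      moreover have *: "Word (l # ls) = Word [l] + Word ls" by (simp add: plus_free_monoid_def)
      ultimately show "B l *\<^sub>v coord_vec n (\<phi> (pdelta (Word ls))) = coord_vec n (\<phi> (pdelta (Word (l # ls))))"
        unfolding * by (intro step) (simp add: sources_def)
    qed (simp_all add: B xc)
    then show ?thesis by (simp add: zero_free_monoid_def)
  qed
  fix r assume "r < dim_vec (coord_vec n (\<phi> p))"
  then have r: "r < n" by (simp add: coord_vec_def)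
  have "(free_eval n B p *\<^sub>v ?x) $ r =
      (\<Sum>k<n. (\<Sum>w\<in>Poly_Mapping.keys p. Poly_Mapping.lookup p w * ?W w $$ (r, k)) * ?x $ k)"
    using r by (subst mult_mat_vec_entry[where n = n])
      (auto simp: free_eval_def xc carrier_matD[OF conjunct1[OF W]] intro!: sum.cong)
  also have "\<dots> = (\<Sum>w\<in>Poly_Mapping.keys p. Poly_Mapping.lookup p w * (\<Sum>k<n. ?W w $$ (r, k) * ?x $ k))"
    unfolding sum_distrib_left sum_distrib_right mult.assoc by (rule sum.swap)
  also have "\<dots> = (\<Sum>w\<in>Poly_Mapping.keys p. Poly_Mapping.lookup p w * Poly_Mapping.lookup (\<phi> (pdelta w)) r)"
  proof (intro sum.cong refl arg_cong2[of _ _ _ _ "(*)"])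
    fix w assume w: "w \<in> Poly_Mapping.keys p"
    have "(\<Sum>k<n. ?W w $$ (r, k) * ?x $ k) = (?W w *\<^sub>v ?x) $ r"
      by (rule mult_mat_vec_entry[OF conjunct1[OF W[OF w]] xc r, symmetric])
    then show "(\<Sum>k<n. ?W w $$ (r, k) * ?x $ k) = Poly_Mapping.lookup (\<phi> (pdelta w)) r"
      unfolding conjunct2[OF W[OF w]] using r by (simp add: coord_vec_def)
  qed
  also have "\<dots> = Poly_Mapping.lookup (\<phi> p) r"
    by (rule lookup_plinear[OF \<phi> finite_keys subset_refl, symmetric])
  finally show "(free_eval n B p *\<^sub>v ?x) $ r = coord_vec n (\<phi> p) $ r"
    using r by (simp add: coord_vec_def)
qed (simp add: free_eval_def coord_vec_def)

text \<open>
  The theorem with its natural size: dimension \<open>uv + 1\<close> holds one vector for each suffix, and the class of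
  \<open>p\<close> is the image of the class of \<open>1\<close> under the value of \<open>p\<close> at the pair constructed from the suffixes.
\<close>

lemma in_spherical_ideal_if_isometric_zero:
  fixes p :: "'g::finite ncpoly"
  assumes g: "CARD('g) > 1" and n: "ncdegree p * num_terms p < n"
    and vanish: "\<And>A :: 'g \<Rightarrow> complex mat. spherical_isometry n A \<Longrightarrow> nc_eval n A p = 0\<^sub>m n n"
  shows "p \<in> spherical_ideal"
proof -
  let ?K = "suffix_words p"
  have card: "card ?K \<le> n" using card_suffix_words[of p] n by linarith
  obtain \<phi> :: "'g ncpoly \<Rightarrow> (nat \<Rightarrow>\<^sub>0 complex)" where \<phi>: "plinear \<phi>"
    "\<forall>x. Poly_Mapping.keys (\<phi> x) \<subseteq> {..<n}"
    "\<forall>x. Poly_Mapping.keys x \<subseteq> ?K \<longrightarrow> (\<phi> x = 0 \<longleftrightarrow> x \<in> spherical_ideal)"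
    by (rule plinear_coordinates_modulo[OF subspace_spherical_ideal finite_suffix_words card])
  obtain B :: "'g letter \<Rightarrow> complex mat" where B: "\<forall>l. B l \<in> carrier_mat n n"
    "mat_sum n (\<lambda>j. B (XT j) * B (X j)) UNIV = 1\<^sub>m n"
    "\<forall>l. \<forall>s\<in>sources ?K l.
      B l *\<^sub>v coord_vec n (\<phi> (pdelta s)) = coord_vec n (\<phi> (pdelta (Word [l] + s)))"
    using left_inverse_pair_extending_words[OF g finite_suffix_words zero_in_suffix_words card \<phi>(1)]
      \<phi>(2,3) by meson
  have Bc: "B l \<in> carrier_mat n n" for l using B(1) by blast
  have "free_eval n B p = 0\<^sub>m n n"
    by (rule free_eval_eq_0_of_isometries[OF vanish Bc B(2)])
  moreover have "free_eval n B p *\<^sub>v coord_vec n (\<phi> (pdelta 0)) = coord_vec n (\<phi> p)"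
    by (rule free_eval_mult_vec[OF Bc \<phi>(1)]) (use B(3) in blast)
  ultimately have zero: "coord_vec n (\<phi> p) = 0\<^sub>m n n *\<^sub>v coord_vec n (\<phi> (pdelta 0))" by simp
  have "Poly_Mapping.lookup (\<phi> p) r = 0" for r
  proof (cases "r < n")
    case True
    then show ?thesis
      using arg_cong[OF zero, of "\<lambda>v. v $ r"] by (simp add: coord_vec_def)
  next
    case False
    then show ?thesis using \<phi>(2) by (auto simp: in_keys_iff subset_iff)
  qed
  then have "\<phi> p = 0" by (intro poly_mapping_eqI) simp
  then show ?thesis using \<phi>(3) keys_subset_suffix_words by blast
qed

theorem theorem4p8:
  fixes p :: "'g::finite ncpoly" and u v n :: nat
  assumes "CARD('g) > 1"
    and "ncdegree p = u" and "u \<ge> 1" and "num_terms p = v"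
    and "n = nat \<lceil>(real CARD('g) + 1) / 2 * real u * real v\<rceil>"
    and "\<And>A :: 'g \<Rightarrow> complex mat. spherical_isometry n A \<Longrightarrow> nc_eval n A p = 0\<^sub>m n n"
  shows "p \<in> spherical_ideal"
proof (cases "v = 0")
  case True
  then have "p = 0" using assms(4) by (simp add: num_terms_def)
  then show ?thesis by (simp add: spherical_ideal_closed)
next
  case False
  have "1 \<le> u * v" using False assms(3) by simp
  then have uv: "1 \<le> real u * real v" by (metis of_nat_1 of_nat_le_iff of_nat_mult)
  have "real (u * v) < 3 / 2 * (real u * real v)" using uv by simp
  also have "\<dots> \<le> (real CARD('g) + 1) / 2 * (real u * real v)"
    using assms(1) uv by (intro mult_right_mono) auto
  also have "\<dots> \<le> real n"
    unfolding assms(5) using of_nat_ceiling[of "(real CARD('g) + 1) / 2 * real u * real v"]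
    by (simp add: mult.assoc)
  finally have "ncdegree p * num_terms p < n"
    unfolding assms(2,4) by (simp only: of_nat_less_iff)
  then show ?thesis
    using in_spherical_ideal_if_isometric_zero[OF assms(1) _ assms(6)] by blast
qed

end
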